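(* Let $(X,d,\mu)$ be a metric measure space, let $\Omega\subset X$ be a bounded open set, let $\nu$ be a Borel regular outer measure on $X$, and let $1\le p\le q<\infty$. (i) If there is a constant $\gamma$ such that $$\nu(F)^{p/q}\le\gamma\,\operatorname{con}_p(F,G,\Omega)$$ for every conductor $G\setminus F$ with $\nu(G)\le\nu(\Omega)/2$, then there is a constant $c$, independent of $u$, such that $$\inf_{a\in\mathbb R}\left(\int_\Omega|u-a|^q\,d\nu\right)^{1/q}\le c\left(\int_\Omega g_u^p\,d\mu\right)^{1/p}$$ for every $u\in N^{1,p}(\Omega)\cap C(\Omega)$ and every $p$-weak upper gradient $g_u$ of $u$ in $\Omega$. (ii) Conversely, if there is a constant $c$, independent of $u$, such that the last inequality holds for every $u\in N^{1,p}(\Omega)\cap C(\Omega)$ and every $p$-weak upper gradient $g_u$ of $u$ in $\Omega$, then there is a constant $\gamma$ such that $\nu(F)^{p/q}\le\gamma\,\operatorname{con}_p(F,G,\Omega)$ for every conductor $G\setminus F$ with $\nu(G)\le\nu(\Omega)/2$.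
   Context: $(X,d)$ is a metric space and $\mu$ is a Borel regular outer measure on $X$ with $0<\mu(B)<\infty$ for every ball $B=B(x,r)=\{y\in X: d(x,y)<r\}$. A path in $\Omega$ is a rectifiable non-constant continuous map from a compact interval to $\Omega$. A family $\Gamma$ of paths has zero $p$-modulus if there is a non-negative Borel function $\rho\in L^p(\Omega)$ with $\int_\gamma\rho\,ds=\infty$ for all $\gamma\in\Gamma$; a property holds for $p$-almost every path if the family of paths for which it fails has zero $p$-modulus. A non-negative measurable function $g$ on $\Omega$ is a $p$-weak upper gradient of a function $u$ on $\Omega$ if for $p$-almost every path $\gamma$ in $\Omega$, with endpoints $x,y$, one has $|u(x)-u(y)|\le\int_\gamma g\,ds$ whenever $u(x),u(y)$ are both finite, and $\int_\gamma g\,ds=\infty$ otherwise. $N^{1,p}(\Omega)$ is the space of $u\in L^p(\Omega,\mu)$ with $\|u\|_{N^{1,p}(\Omega)}=\left(\int_\Omega|u|^p\,d\mu+\inf_g\int_\Omega g^p\,d\mu\right)^{1/p}<\infty$ (infimum over $p$-weak upper gradients $g$ of $u$ in $\Omega$), modulo $u\sim v$ iff $\|u-v\|_{N^{1,p}(\Omega)}=0$. $C(\Omega)$ denotes the continuous functions on $\Omega$. A conductor is a set $G\setminus F$ where $G\subset\Omega$ is open, $F$ is a closed subset of $\Omega$ (closed relative to $\Omega$), and $F\subset G$ (a conductor is understood together with its pair $(F,G)$). Let $\mathcal B(F,G,\Omega)=\{u\in N^{1,p}(\Omega)\cap C(\Omega): u\ge1\text{ in }F,\ u\le0\text{ in }\Omega\setminus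 G\}$. The $p$-conductivity of the conductor is $$\operatorname{con}_p(F,G,\Omega)=\inf_{u\in\mathcal B(F,G,\Omega)}\int_\Omega g_u^p\,d\mu,$$ the infimum being also over the $p$-weak upper gradients $g_u$ of $u$ in $\Omega$, and being $\infty$ if $\mathcal B(F,G,\Omega)=\emptyset$.
   Formalization: In (ii) the conductors must also satisfy ν(G)<∞ (automatic if ν(Ω)<∞); otherwise (ii) fails: for X=Ω={x0}, μ({x0})=1, ν({x0})=∞ the Poincaré inequality holds, but F=G=Ω has con_p=0 and ν(F)=∞. *)

theory Defs
  imports "HOL-Analysis.Analysis"
begin

text \<open>The power \<open>x\<^sup>r\<close> on \<open>[0,\<infinity>]\<close>, for \<open>r > 0\<close>.\<close>

definition epowr :: "ennreal \<Rightarrow> real \<Rightarrow> ennreal" where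
  "epowr x r = (if x = \<infinity> then \<infinity> else ennreal (enn2real x powr r))"


section \<open>Borel regular outer measures\<close>

text \<open>\<open>lambda_system UNIV (Pow UNIV) \<mu>\<close> is the collection of the sets that are measurable
  for \<open>\<mu>\<close> in the sense of Caratheodory.\<close>

definition borel_regular_outer_measure :: "('a::topological_space set \<Rightarrow> ennreal) \<Rightarrow> bool" where
  "borel_regular_outer_measure \<mu> \<longleftrightarrow>
     outer_measure_space (Pow UNIV) \<mu> \<and>
     sets borel \<subseteq> lambda_system UNIV (Pow UNIV) \<mu> \<and>
     (\<forall>A. \<exists>B\<in>sets borel. A \<subseteq> B \<and> \<mu> B = \<mu> A)"

text \<open>Measurability and integrals with respect to \<open>\<mu>\<close> refer to the following (complete) measure.\<close>

definition caratheodory_measure :: "('a set \<Rightarrow> ennreal) \<Rightarrow> 'a measure" where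
  "caratheodory_measure \<mu> = measure_of UNIV (lambda_system UNIV (Pow UNIV) \<mu>) \<mu>"

lemma
  assumes "borel_regular_outer_measure \<mu>"
  shows sets_caratheodory_measure:
      "sets (caratheodory_measure \<mu>) = lambda_system UNIV (Pow UNIV) \<mu>"
    and emeasure_caratheodory_measure:
      "A \<in> sets (caratheodory_measure \<mu>) \<Longrightarrow> emeasure (caratheodory_measure \<mu>) A = \<mu> A"
proof -
  interpret sigma_algebra UNIV "Pow UNIV" by (rule sigma_algebra_Pow)
  have ms: "measure_space UNIV (lambda_system UNIV (Pow UNIV) \<mu>) \<mu>"
    using assms caratheodory_lemma[of \<mu>]
    unfolding borel_regular_outer_measure_def by auto
  then interpret L: sigma_algebra UNIV "lambda_system UNIV (Pow UNIV) \<mu>"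
    by (simp add: measure_space_def)
  show s: "sets (caratheodory_measure \<mu>) = lambda_system UNIV (Pow UNIV) \<mu>"
    unfolding caratheodory_measure_def by (rule L.sets_measure_of_eq)
  show "emeasure (caratheodory_measure \<mu>) A = \<mu> A" if "A \<in> sets (caratheodory_measure \<mu>)"
    using that ms s L.space_closed
    by (intro emeasure_measure_of[OF caratheodory_measure_def])
       (auto simp: measure_space_def)
qed


section \<open>Paths and path integrals\<close>

text \<open>A path \<open>\<gamma> : [a,b] \<rightarrow> X\<close> is encoded as the triple \<open>(a, b, \<gamma>)\<close>; the values of \<open>\<gamma>\<close> outside
  \<open>[a,b]\<close> are irrelevant.\<close>

type_synonym 'a curve = "real \<times> real \<times> (real \<Rightarrow> 'a)"

definition curve_length :: "(real \<Rightarrow> 'a::metric_space) \<Rightarrow> real \<Rightarrow> real \<Rightarrow> ennreal" where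
  "curve_length \<gamma> a b =
     (SUP (n, t) \<in> {(n::nat, t::nat \<Rightarrow> real). mono_on {..n} t \<and> t ` {..n} \<subseteq> {a..b}}.
        \<Sum>i<n. ennreal (dist (\<gamma> (t i)) (\<gamma> (t (Suc i)))))"

definition paths_in :: "'a::metric_space set \<Rightarrow> 'a curve set" where
  "paths_in \<Omega> = {(a, b, \<gamma>). a \<le> b \<and> continuous_on {a..b} \<gamma> \<and> \<gamma> ` {a..b} \<subseteq> \<Omega> \<and>
     curve_length \<gamma> a b < \<infinity> \<and> \<not> \<gamma> constant_on {a..b}}"

text \<open>\<open>arc_length_param \<gamma> a b s = \<gamma> t\<close> for any \<open>t \<in> [a,b]\<close> such that the restriction of
  \<open>\<gamma>\<close> to \<open>[a,t]\<close> has length \<open>s\<close>; the value does not depend on the choice of \<open>t\<close>, since \<open>\<gamma>\<close> is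
  constant between any two such parameters.\<close>

definition arc_length_param :: "(real \<Rightarrow> 'a::metric_space) \<Rightarrow> real \<Rightarrow> real \<Rightarrow> real \<Rightarrow> 'a" where
  "arc_length_param \<gamma> a b s =
     \<gamma> (SOME t. t \<in> {a..b} \<and> curve_length \<gamma> a t = ennreal s)"

text \<open>The integral of \<open>\<rho>\<close> along \<open>\<gamma>\<close> with respect to arc length.\<close>

definition path_integral :: "('a::metric_space \<Rightarrow> ennreal) \<Rightarrow> 'a curve \<Rightarrow> ennreal" where
  "path_integral \<rho> = (\<lambda>(a, b, \<gamma>).
     \<integral>\<^sup>+ s \<in> {0..enn2real (curve_length \<gamma> a b)}. \<rho> (arc_length_param \<gamma> a b s) \<partial>lborel)"


section \<open>Modulus and weak upper gradients\<close>

definition zero_modulus ::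
  "('a::metric_space set \<Rightarrow> ennreal) \<Rightarrow> 'a set \<Rightarrow> real \<Rightarrow> 'a curve set \<Rightarrow> bool" where
  "zero_modulus \<mu> \<Omega> p \<Gamma> \<longleftrightarrow>
     (\<exists>\<rho> :: 'a \<Rightarrow> ennreal. \<rho> \<in> borel_measurable (restrict_space borel \<Omega>) \<and>
        (\<integral>\<^sup>+ x\<in>\<Omega>. epowr (\<rho> x) p \<partial>caratheodory_measure \<mu>) < \<infinity> \<and>
        (\<forall>c\<in>\<Gamma>. path_integral \<rho> c = \<infinity>))"

definition almost_every_path ::
  "('a::metric_space set \<Rightarrow> ennreal) \<Rightarrow> 'a set \<Rightarrow> real \<Rightarrow> ('a curve \<Rightarrow> bool) \<Rightarrow> bool" where
  "almost_every_path \<mu> \<Omega> p P \<longleftrightarrow> zero_modulus \<mu> \<Omega> p {c \<in> paths_in \<Omega>. \<not> P c}"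

text \<open>The functions \<open>u\<close> on \<open>\<Omega>\<close> may take the values \<open>\<plusminus>\<infinity>\<close>; only their values in \<open>\<Omega>\<close> matter.
  The function \<open>g\<close> is only measurable with respect to \<open>\<mu>\<close>, but it agrees with a Borel function
  outside of a null set, which almost every path meets in zero length, so that \<open>g\<close> is
  Lebesgue measurable along almost every path.\<close>

definition weak_upper_gradient ::
  "('a::metric_space set \<Rightarrow> ennreal) \<Rightarrow> 'a set \<Rightarrow> real \<Rightarrow> ('a \<Rightarrow> ereal) \<Rightarrow> ('a \<Rightarrow> ennreal) \<Rightarrow> bool" where
  "weak_upper_gradient \<mu> \<Omega> p u g \<longleftrightarrow>
     g \<in> borel_measurable (restrict_space (caratheodory_measure \<mu>) \<Omega>) \<and>
     almost_every_path \<mu> \<Omega> p (\<lambda>(a, b, \<gamma>).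
       if \<bar>u (\<gamma> a)\<bar> \<noteq> \<infinity> \<and> \<bar>u (\<gamma> b)\<bar> \<noteq> \<infinity>
       then e2ennreal \<bar>u (\<gamma> a) - u (\<gamma> b)\<bar> \<le> path_integral g (a, b, \<gamma>)
       else path_integral g (a, b, \<gamma>) = \<infinity>)"


section \<open>Newtonian functions\<close>

definition newtonian_norm ::
  "('a::metric_space set \<Rightarrow> ennreal) \<Rightarrow> 'a set \<Rightarrow> real \<Rightarrow> ('a \<Rightarrow> ereal) \<Rightarrow> ennreal" where
  "newtonian_norm \<mu> \<Omega> p u = epowr
     ((\<integral>\<^sup>+ x\<in>\<Omega>. epowr (e2ennreal \<bar>u x\<bar>) p \<partial>caratheodory_measure \<mu>) +
      (INF g \<in> {g. weak_upper_gradient \<mu> \<Omega> p u g}.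
         \<integral>\<^sup>+ x\<in>\<Omega>. epowr (g x) p \<partial>caratheodory_measure \<mu>)) (1 / p)"

text \<open>The functions which represent the elements of \<open>N\<^sup>1\<^sup>,\<^sup>p(\<Omega>)\<close>, that is, before the passage to
  equivalence classes.  Finiteness of the norm includes that \<open>u\<close> is in \<open>L\<^sup>p(\<Omega>)\<close>.\<close>

definition newtonian ::
  "('a::metric_space set \<Rightarrow> ennreal) \<Rightarrow> 'a set \<Rightarrow> real \<Rightarrow> ('a \<Rightarrow> ereal) set" where
  "newtonian \<mu> \<Omega> p =
     {u. u \<in> borel_measurable (restrict_space (caratheodory_measure \<mu>) \<Omega>) \<and>
         newtonian_norm \<mu> \<Omega> p u < \<infinity>}"

text \<open>\<open>N\<^sup>1\<^sup>,\<^sup>p(\<Omega>) \<inter> C(\<Omega>)\<close>; continuous functions are real-valued.\<close>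

definition newtonian_continuous ::
  "('a::metric_space set \<Rightarrow> ennreal) \<Rightarrow> 'a set \<Rightarrow> real \<Rightarrow> ('a \<Rightarrow> real) set" where
  "newtonian_continuous \<mu> \<Omega> p =
     {u. continuous_on \<Omega> u \<and> (\<lambda>x. ereal (u x)) \<in> newtonian \<mu> \<Omega> p}"


section \<open>Conductors\<close>

text \<open>A conductor \<open>G - F\<close> is represented by its pair \<open>(F, G)\<close>.\<close>

definition conductor :: "'a::metric_space set \<Rightarrow> 'a set \<Rightarrow> 'a set \<Rightarrow> bool" where
  "conductor \<Omega> F G \<longleftrightarrow>
     open G \<and> G \<subseteq> \<Omega> \<and> closedin (top_of_set \<Omega>) F \<and> F \<subseteq> G"

definition conductor_admissible ::
  "('a::metric_space set \<Rightarrow> ennreal) \<Rightarrow> real \<Rightarrow> 'a set \<Rightarrow> 'a set \<Rightarrow> 'a set \<Rightarrow> ('a \<Rightarrow> real) set" where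
  "conductor_admissible \<mu> p F G \<Omega> =
     {u \<in> newtonian_continuous \<mu> \<Omega> p. (\<forall>x\<in>F. u x \<ge> 1) \<and> (\<forall>x\<in>\<Omega> - G. u x \<le> 0)}"

definition conductivity ::
  "('a::metric_space set \<Rightarrow> ennreal) \<Rightarrow> real \<Rightarrow> 'a set \<Rightarrow> 'a set \<Rightarrow> 'a set \<Rightarrow> ennreal" where
  "conductivity \<mu> p F G \<Omega> =
     (INF u \<in> conductor_admissible \<mu> p F G \<Omega>.
        INF g \<in> {g. weak_upper_gradient \<mu> \<Omega> p (\<lambda>x. ereal (u x)) g}.
          \<integral>\<^sup>+ x\<in>\<Omega>. epowr (g x) p \<partial>caratheodory_measure \<mu>)"

end

theory Submission
  imports Defs
begin

text \<open>
  The two directions rest on the same observation: the functions that are admissible for a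
  conductor and the truncations of a function between two of its levels are the same kind of
  object.

  From the Poincare inequality to the conductor inequality, let \<open>u\<close> be admissible for \<open>(F, G)\<close>.
  Every constant \<open>a\<close> differs from \<open>u\<close> by at least \<open>1 / 2\<close> on \<open>F\<close> or on \<open>\<Omega> - G\<close>, and each of these sets
  has at least measure \<open>\<nu> F\<close>.  So the left side of the Poincare inequality is at least
  \<open>\<nu>(F)\<^sup>1\<^sup>/\<^sup>q / 2\<close> (\<open>conductor_half_oscillation\<close>).

  In the other direction, the conductor \<open>(\<Omega>, \<Omega>)\<close> first shows that \<open>\<nu> \<Omega>\<close> is finite
  (\<open>finite_of_conductor_inequality\<close>), so that \<open>u\<close> has a median \<open>m\<close> with respect to \<open>\<nu>\<close>.  The positive
  parts of \<open>u - m\<close> and \<open>m - u\<close> are then treated separately by Maz'ya's truncation method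
  (\<open>positive_part_estimate\<close>): the superlevel sets at the levels \<open>l / 2\<close> and \<open>l\<close>, with \<open>l\<close> a power of 4,
  form conductors to which the hypothesis applies, since all of them lie on one side of the median.
  Rescaled truncations of \<open>u\<close> are admissible for them, and their energies live in disjoint level bands.
  Summation over the levels uses \<open>p \<le> q\<close> in the form of the superadditivity of \<open>t \<mapsto> t\<^sup>q\<^sup>/\<^sup>p\<close>.

  The geometric input is that a weak upper gradient of a truncation may be taken to vanish outside
  of the corresponding level band (\<open>weak_upper_gradient_truncation\<close>).  When a path crosses the
  band, it contains a subpath in the band which already realizes the oscillation of the
  truncation.  Hence it must be shown that path integrals do not increase under passage to
  subpaths (\<open>path_integral_subpath_le\<close>); this needs the additivity and the continuity of length along
  a rectifiable path, which make the arc length parametrization of a subpath a translate of that of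
  the path.
\<close>

section \<open>Powers on the extended half-line\<close>

lemma epowr_top [simp]: "epowr \<infinity> r = \<infinity>" "epowr top r = top"
  by (simp_all add: epowr_def)

lemma epowr_ennreal: "0 \<le> x \<Longrightarrow> epowr (ennreal x) r = ennreal (x powr r)"
  by (simp add: epowr_def)

lemma epowr_0 [simp]: "epowr 0 r = 0"
  by (simp add: epowr_def)

lemma epowr_exponent_one [simp]: "epowr x 1 = x"
  by (cases x) (simp_all add: epowr_ennreal)

lemma epowr_eq_top_iff [simp]: "epowr x r = top \<longleftrightarrow> x = top"
  by (simp add: epowr_def)

lemma epowr_less_top_iff: "epowr x r < top \<longleftrightarrow> x < top"
  by (simp add: less_top[symmetric])

lemma epowr_mono:
  assumes "0 \<le> r" "x \<le> y"
  shows "epowr x r \<le> epowr y r"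
proof (cases y)
  case y: (real b)
  then have "x < top" using assms(2) by (metis ennreal_less_top le_less_trans)
  then obtain a where a: "0 \<le> a" "x = ennreal a" by (cases x) auto
  then have "a \<le> b" using assms(2) y by (simp add: ennreal_le_iff)
  then show ?thesis using a y assms(1) by (simp add: epowr_ennreal ennreal_leI powr_mono2)
qed simp

lemma epowr_mult:
  "epowr (x * y) r = epowr x r * epowr y r"
proof (cases "x = top \<or> y = top")
  case True
  then show ?thesis
    by (cases "x = 0 \<or> y = 0")
       (auto simp: ennreal_mult_top ennreal_top_mult epowr_def ennreal_mult_eq_top_iff 
          enn2real_eq_0_iff ennreal_eq_0_iff)
next
  case False
  then obtain a b where "0 \<le> a" "x = ennreal a" "0 \<le> b" "y = ennreal b"
    by (metis ennreal_cases)
  then show ?thesis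
    by (simp add: epowr_ennreal ennreal_mult[symmetric] powr_mult)
qed

lemma epowr_epowr: "epowr (epowr x r) s = epowr x (r * s)"
  by (cases x) (simp_all add: epowr_ennreal powr_powr)

text \<open>Writing \<open>x\<^sup>s = x \<cdot> x\<^sup>s\<^sup>-\<^sup>1\<close> and bounding the second factor by \<open>(x + y)\<^sup>s\<^sup>-\<^sup>1\<close>
  gives the inequality.\<close>

lemma epowr_superadd:
  assumes "1 \<le> s"
  shows "epowr x s + epowr y s \<le> epowr (x + y) s"
proof (cases "x = top \<or> y = top")
  case False
  then obtain a b where ab: "0 \<le> a" "x = ennreal a" "0 \<le> b" "y = ennreal b"
    by (metis ennreal_cases)
  have split: "c powr s = c * c powr (s - 1)" if "0 \<le> c" for c :: real
    using that by (cases "c = 0") (simp_all add: powr_diff)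
  have "a powr s + b powr s = a * a powr (s - 1) + b * b powr (s - 1)"
    using ab split by simp
  also have "\<dots> \<le> a * (a + b) powr (s - 1) + b * (a + b) powr (s - 1)"
    using ab assms by (intro add_mono mult_left_mono powr_mono2) auto
  also have "\<dots> = (a + b) powr s"
    using ab split[of "a + b"] by (simp add: distrib_right)
  finally show ?thesis
    using ab by (simp add: epowr_ennreal ennreal_plus[symmetric] ennreal_leI del: ennreal_plus)
qed auto

text \<open>With \<open>s = q / p\<close> this lets the sum of the
  \<open>q / p\<close>-th powers of the energies of the level bands be estimated by the \<open>q / p\<close>-th power of the
  total energy.\<close>

lemma suminf_epowr_le:
  assumes "1 \<le> s"
  shows "(\<Sum>n. epowr (f n) s) \<le> epowr (\<Sum>n. f n) s"
proof (rule suminf_le_const)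
  fix N
  have "(\<Sum>n<N. epowr (f n) s) \<le> epowr (\<Sum>n<N. f n) s"
  proof (induction N)
    case (Suc N)
    have "(\<Sum>n<Suc N. epowr (f n) s) \<le> epowr (\<Sum>n<N. f n) s + epowr (f N) s"
      using Suc by (simp add: add_right_mono)
    also have "\<dots> \<le> epowr (\<Sum>n<Suc N. f n) s"
      using epowr_superadd[OF assms] by simp
    finally show ?case .
  qed simp
  also have "\<dots> \<le> epowr (\<Sum>n. f n) s"
    using assms by (intro epowr_mono sum_le_suminf) auto
  finally show "(\<Sum>n<N. epowr (f n) s) \<le> epowr (\<Sum>n. f n) s" .
qed simp

lemma measurable_epowr [measurable]: "(\<lambda>x. epowr x r) \<in> borel_measurable borel"
  unfolding epowr_def by measurable

section \<open>Length of curves\<close>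

lemma inscribed_polygon_le_curve_length:
  assumes "mono_on {..n} t" "t ` {..n} \<subseteq> {a..b}"
  shows "(\<Sum>i<n. ennreal (dist (\<gamma> (t i)) (\<gamma> (t (Suc i))))) \<le> curve_length \<gamma> a b"
  unfolding curve_length_def using assms
  by (intro SUP_upper2[of "(n, t)"]) auto

lemma curve_length_leI:
  assumes "\<And>n t. mono_on {..n} t \<Longrightarrow> t ` {..n} \<subseteq> {a..b} \<Longrightarrow>
     (\<Sum>i<n. ennreal (dist (\<gamma> (t i)) (\<gamma> (t (Suc i))))) \<le> C"
  shows "curve_length \<gamma> a b \<le> C"
  unfolding curve_length_def using assms by (intro SUP_least) auto

lemma add_curve_length_leI:
  assumes "a \<le> b"
    and "\<And>n t. mono_on {..n} t \<Longrightarrow> t ` {..n} \<subseteq> {a..b} \<Longrightarrow>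
     x + (\<Sum>i<n. ennreal (dist (\<gamma> (t i)) (\<gamma> (t (Suc i))))) \<le> C"
  shows "x + curve_length \<gamma> a b \<le> C"
proof -
  have ne: "{(n::nat, t::nat \<Rightarrow> real). mono_on {..n} t \<and> t ` {..n} \<subseteq> {a..b}} \<noteq> {}"
    using assms(1) by (auto simp: mono_on_def intro!: exI[of _ 0] exI[of _ "\<lambda>_. b"])
  show ?thesis
    unfolding curve_length_def ennreal_SUP_add_right[OF ne] using assms(2)
    by (intro SUP_least) auto
qed

lemma curve_length_ge_dist:
  assumes "a \<le> b"
  shows "ennreal (dist (\<gamma> a) (\<gamma> b)) \<le> curve_length \<gamma> a b"
  using inscribed_polygon_le_curve_length[of 1 "\<lambda>i. if i = 0 then a else b" a b \<gamma>] assms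
  by (auto simp: mono_on_def image_subset_iff)

text \<open>Comparing a polygon with its two clipped copies \<open>min t y\<close> and \<open>max t y\<close> replaces the insertion of
  the point \<open>y\<close> into a partition: only the segment that straddles \<open>y\<close> is affected, and there the
  claim is the triangle inequality through \<open>\<gamma> y\<close>.\<close>

lemma dist_le_clip:
  fixes \<gamma> :: "real \<Rightarrow> 'a::metric_space"
  assumes "x \<le> x'"
  shows "ennreal (dist (\<gamma> x) (\<gamma> x')) \<le> ennreal (dist (\<gamma> (min x y)) (\<gamma> (min x' y)))
           + ennreal (dist (\<gamma> (max x y)) (\<gamma> (max x' y)))"
proof -
  have "dist (\<gamma> x) (\<gamma> x') \<le> dist (\<gamma> (min x y)) (\<gamma> (min x' y)) + dist (\<gamma> (max x y)) (\<gamma> (max x' y))"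
    using assms dist_triangle[of "\<gamma> x" "\<gamma> x'" "\<gamma> y"] by (auto simp: min_def max_def)
  then show ?thesis by (simp add: ennreal_plus[symmetric] ennreal_leI del: ennreal_plus)
qed

lemma polygon_le_clip:
  fixes \<gamma> :: "real \<Rightarrow> 'a::metric_space"
  assumes "mono_on {..n} t"
  shows "(\<Sum>i<n. ennreal (dist (\<gamma> (t i)) (\<gamma> (t (Suc i)))))
    \<le> (\<Sum>i<n. ennreal (dist (\<gamma> (min (t i) y)) (\<gamma> (min (t (Suc i)) y)))) +
       (\<Sum>i<n. ennreal (dist (\<gamma> (max (t i) y)) (\<gamma> (max (t (Suc i)) y))))"
  unfolding sum.distrib[symmetric]
  by (intro sum_mono dist_le_clip) (use assms in \<open>auto simp: mono_on_def\<close>)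

lemma mono_on_clip:
  fixes t :: "nat \<Rightarrow> real"
  assumes "mono_on {..n} t"
  shows "mono_on {..n} (\<lambda>i. min (t i) y)" "mono_on {..n} (\<lambda>i. max (t i) y)"
  using assms unfolding mono_on_def by (meson order_refl min.mono max.mono)+

text \<open>A polygon inscribed in the whole curve is at most its clipping to \<open>[a, b]\<close> plus its clipping
  to \<open>[b, c]\<close>; conversely, polygons inscribed in the two pieces can be concatenated.\<close>

lemma curve_length_add:
  assumes "a \<le> b" "b \<le> c"
  shows "curve_length \<gamma> a c = curve_length \<gamma> a b + curve_length \<gamma> b c"
proof (rule antisym)
  show "curve_length \<gamma> a c \<le> curve_length \<gamma> a b + curve_length \<gamma> b c"
  proof (rule curve_length_leI)
    fix n and t :: "nat \<Rightarrow> real"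
    assume t: "mono_on {..n} t" "t ` {..n} \<subseteq> {a..c}"
    show "(\<Sum>i<n. ennreal (dist (\<gamma> (t i)) (\<gamma> (t (Suc i)))))
        \<le> curve_length \<gamma> a b + curve_length \<gamma> b c"
      using assms t
      by (intro order_trans[OF polygon_le_clip[OF t(1), where y = b] add_mono]
            inscribed_polygon_le_curve_length mono_on_clip) auto
  qed
next
  have concat: "(\<Sum>i<n. ennreal (dist (\<gamma> (t i)) (\<gamma> (t (Suc i))))) +
        (\<Sum>i<m. ennreal (dist (\<gamma> (t' i)) (\<gamma> (t' (Suc i))))) \<le> curve_length \<gamma> a c"
    if t: "mono_on {..n} t" "t ` {..n} \<subseteq> {a..b}"
      and t': "mono_on {..m} t'" "t' ` {..m} \<subseteq> {b..c}" for n m t t'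
  proof -
    define T where "T i = (if i \<le> n then t i else t' (i - Suc n))" for i
    have bounds: "a \<le> t i" "t i \<le> b" if "i \<le> n" for i using t(2) that by auto
    have bounds': "b \<le> t' i" "t' i \<le> c" if "i \<le> m" for i using t'(2) that by auto
    have "mono_on {..Suc n + m} T"
    proof (rule mono_onI)
      fix i j assume ij: "i \<in> {..Suc n + m}" "j \<in> {..Suc n + m}" "i \<le> j"
      consider "j \<le> n" | "i \<le> n" "n < j" | "n < i" by linarith
      then show "T i \<le> T j"
      proof cases
        case 1 then show ?thesis using ij t(1) by (auto simp: T_def mono_on_def)
      next
        case 2
        then have "t i \<le> b" "b \<le> t' (j - Suc n)" using ij bounds bounds' by auto
        then show ?thesis using 2 by (auto simp: T_def)
      next
        case 3
        then have "t' (i - Suc n) \<le> t' (j - Suc n)"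
          using ij t'(1) by (intro mono_onD[OF t'(1)]) auto
        then show ?thesis using 3 ij by (auto simp: T_def)
      qed
    qed
    moreover have "T ` {..Suc n + m} \<subseteq> {a..c}"
    proof (rule image_subsetI)
      fix i assume "i \<in> {..Suc n + m}"
      then have "i - Suc n \<le> m" by auto
      then show "T i \<in> {a..c}"
        using bounds[of i] bounds'[of "i - Suc n"] assms by (auto simp: T_def intro: order_trans)
    qed
    ultimately have le: "(\<Sum>i<Suc n + m. ennreal (dist (\<gamma> (T i)) (\<gamma> (T (Suc i))))) \<le> curve_length \<gamma> a c"
      by (rule inscribed_polygon_le_curve_length)
    let ?d = "\<lambda>i. ennreal (dist (\<gamma> (T i)) (\<gamma> (T (Suc i))))"
    have "(\<Sum>i<Suc n + m. f i) = (\<Sum>i<n. f i) + f n + (\<Sum>i<m. f (Suc n + i))" for f :: "nat \<Rightarrow> ennreal"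
      by (induction m) (simp_all add: add.assoc)
    then have "(\<Sum>i<Suc n + m. ?d i) = (\<Sum>i<n. ?d i) + ?d n + (\<Sum>i<m. ?d (Suc n + i))" .
    then have "(\<Sum>i<n. ?d i) + (\<Sum>i<m. ?d (Suc n + i)) \<le> (\<Sum>i<Suc n + m. ?d i)"
      by (simp only:) (intro add_right_mono add_increasing2, auto)
    also note le
    also have "(\<Sum>i<n. ?d i) = (\<Sum>i<n. ennreal (dist (\<gamma> (t i)) (\<gamma> (t (Suc i)))))"
      by (rule sum.cong) (auto simp: T_def)
    also have "(\<Sum>i<m. ?d (Suc n + i)) = (\<Sum>i<m. ennreal (dist (\<gamma> (t' i)) (\<gamma> (t' (Suc i)))))"
      by (rule sum.cong) (auto simp: T_def Suc_diff_le)
    finally show ?thesis .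
  qed
  show "curve_length \<gamma> a b + curve_length \<gamma> b c \<le> curve_length \<gamma> a c"
    by (rule add_curve_length_leI[OF assms(2)], subst add.commute,
        rule add_curve_length_leI[OF assms(1)], subst add.commute, rule concat)
qed

lemma curve_length_mono:
  assumes "a \<le> s" "s \<le> t" "t \<le> b"
  shows "curve_length \<gamma> s t \<le> curve_length \<gamma> a b"
proof -
  have "curve_length \<gamma> a b = curve_length \<gamma> a s + (curve_length \<gamma> s t + curve_length \<gamma> t b)"
    using curve_length_add[of a s b \<gamma>] curve_length_add[of s t b \<gamma>] assms by simp
  then show ?thesis
    by (simp add: add_increasing add_increasing2)
qed

text \<open>Length is uniformly continuous along a continuous rectifiable curve.  Fix a polygon with \<open>n\<close>
  segments whose length is within \<open>e / 2\<close> of the total.  Clipping it to a short interval \<open>[y, y']\<close>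
  leaves at most \<open>n\<close> segments, each of them short by the uniform continuity of \<open>\<gamma>\<close>, so together they have
  length at most \<open>e / 2\<close>.  Hence the pieces outside \<open>[y, y']\<close> account for all but \<open>e\<close> of the length.\<close>

lemma curve_length_short:
  fixes \<gamma> :: "real \<Rightarrow> 'a::metric_space"
  assumes cont: "continuous_on {a..b} \<gamma>" and fin: "curve_length \<gamma> a b < \<infinity>" and "0 < e"
  shows "\<exists>\<delta>>0. \<forall>y y'. a \<le> y \<and> y \<le> y' \<and> y' \<le> b \<and> y' - y < \<delta> \<longrightarrow> curve_length \<gamma> y y' \<le> ennreal e"
proof (cases "a \<le> b")
  case True
  let ?poly = "\<lambda>n t. \<Sum>i<n. ennreal (dist (\<gamma> (t i)) (\<gamma> (t (Suc i))))"
  have "\<exists>n t. mono_on {..n} t \<and> t ` {..n} \<subseteq> {a..b} \<and> curve_length \<gamma> a b < ?poly n t + ennreal (e / 2)"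
  proof (rule ccontr)
    assume "\<not> ?thesis"
    then have "?poly n t + ennreal (e / 2) \<le> curve_length \<gamma> a b"
      if "mono_on {..n} t" "t ` {..n} \<subseteq> {a..b}" for n t
      using that not_less by blast
    then have "?poly n t \<le> curve_length \<gamma> a b - ennreal (e / 2)"
      if "mono_on {..n} t" "t ` {..n} \<subseteq> {a..b}" for n t
      using that by (simp add: ennreal_le_minus_iff add.commute)
    then have "curve_length \<gamma> a b \<le> curve_length \<gamma> a b - ennreal (e / 2)"
      by (intro curve_length_leI) auto
    moreover have "ennreal (e / 2) \<le> curve_length \<gamma> a b"
      using \<open>\<And>n t. _ \<Longrightarrow> _ \<Longrightarrow> ?poly n t + ennreal (e / 2) \<le> _\<close>[of 0 "\<lambda>_. a"] True
      by (simp add: mono_on_def)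
    ultimately show False
      using fin \<open>0 < e\<close> by (cases "curve_length \<gamma> a b") (auto simp: ennreal_minus ennreal_le_iff)
  qed
  then obtain n t where t: "mono_on {..n} t" "t ` {..n} \<subseteq> {a..b}"
      and near: "curve_length \<gamma> a b < ?poly n t + ennreal (e / 2)"
    by blast
  \<comment> \<open>the summand 1 keeps the denominator nonzero for the polygon without segments\<close>
  define \<eta> where "\<eta> = e / (2 * (real n + 1))"
  have "\<eta> > 0" using \<open>0 < e\<close> by (simp add: \<eta>_def)
  moreover have "uniformly_continuous_on {a..b} \<gamma>"
    using cont by (intro compact_uniformly_continuous) auto
  ultimately obtain \<delta> where "\<delta> > 0"
      and \<delta>: "\<And>x x'. x \<in> {a..b} \<Longrightarrow> x' \<in> {a..b} \<Longrightarrow> dist x' x < \<delta> \<Longrightarrow> dist (\<gamma> x') (\<gamma> x) < \<eta>"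
    unfolding uniformly_continuous_on_def by metis
  have "curve_length \<gamma> y y' \<le> ennreal e" if y: "a \<le> y" "y \<le> y'" "y' \<le> b" "y' - y < \<delta>" for y y'
  proof -
    define t1 where "t1 i = min (t i) y" for i
    define t2 where "t2 i = max (t i) y" for i
    define t3 where "t3 i = min (t2 i) y'" for i
    define t4 where "t4 i = max (t2 i) y'" for i
    have m2: "mono_on {..n} t2"
      unfolding t2_def by (rule mono_on_clip(2)[OF t(1)])
    have mono: "mono_on {..n} t1" "mono_on {..n} t4"
      unfolding t1_def t4_def by (rule mono_on_clip t(1) m2)+
    have range: "t1 ` {..n} \<subseteq> {a..y}" "t4 ` {..n} \<subseteq> {y'..b}"
      using t(2) y by (auto simp: t1_def t4_def t2_def)
    have "?poly n t \<le> ?poly n t1 + (?poly n t3 + ?poly n t4)"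
      using polygon_le_clip[OF t(1), of \<gamma> y] polygon_le_clip[OF m2, of \<gamma> y']
      unfolding t1_def[symmetric] t2_def[symmetric] t3_def[symmetric] t4_def[symmetric]
      by (meson add_left_mono order_trans)
    also have "\<dots> \<le> curve_length \<gamma> a y + (ennreal (e / 2) + curve_length \<gamma> y' b)"
    proof (intro add_mono inscribed_polygon_le_curve_length)
      have "?poly n t3 \<le> (\<Sum>i<n. ennreal \<eta>)"
      proof (rule sum_mono)
        fix i
        have "t3 i \<in> {y..y'}" "t3 (Suc i) \<in> {y..y'}" using y by (auto simp: t3_def t2_def)
        then have "dist (\<gamma> (t3 i)) (\<gamma> (t3 (Suc i))) < \<eta>"
          using y by (intro \<delta>) (auto simp: dist_real_def)
        then show "ennreal (dist (\<gamma> (t3 i)) (\<gamma> (t3 (Suc i)))) \<le> ennreal \<eta>"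
          by (intro ennreal_leI) simp
      qed
      also have "\<dots> = ennreal (real n * \<eta>)"
        using \<open>\<eta> > 0\<close> by (simp add: ennreal_mult ennreal_of_nat_eq_real_of_nat)
      also have "\<dots> \<le> ennreal (e / 2)"
        using \<open>0 < e\<close> by (intro ennreal_leI) (simp add: \<eta>_def field_simps)
      finally show "?poly n t3 \<le> ennreal (e / 2)" .
    qed (fact mono range)+
    finally have poly: "?poly n t \<le> curve_length \<gamma> a y + (ennreal (e / 2) + curve_length \<gamma> y' b)" .
    have "curve_length \<gamma> a y + (curve_length \<gamma> y' b + curve_length \<gamma> y y') = curve_length \<gamma> a b"
      using curve_length_add[of a y b \<gamma>] curve_length_add[of y y' b \<gamma>] y by (simp add: add_ac)
    also have "\<dots> \<le> ?poly n t + ennreal (e / 2)"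
      using near by simp
    also note add_right_mono[OF poly, of "ennreal (e / 2)"]
    also have "curve_length \<gamma> a y + (ennreal (e / 2) + curve_length \<gamma> y' b) + ennreal (e / 2)
        = curve_length \<gamma> a y + (curve_length \<gamma> y' b + (ennreal (e / 2) + ennreal (e / 2)))"
      by (simp only: add_ac)
    also have "ennreal (e / 2) + ennreal (e / 2) = ennreal e"
      using \<open>0 < e\<close> by (simp add: ennreal_plus[symmetric] del: ennreal_plus)
    finally have "curve_length \<gamma> a y + (curve_length \<gamma> y' b + curve_length \<gamma> y y')
        \<le> curve_length \<gamma> a y + (curve_length \<gamma> y' b + ennreal e)" .
    moreover have "curve_length \<gamma> a y \<noteq> top" "curve_length \<gamma> y' b \<noteq> top"
      using fin curve_length_mono[of a a y b \<gamma>] curve_length_mono[of a y' b b \<gamma>] y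
      by (auto simp: top_unique)
    ultimately show ?thesis
      by (simp add: ennreal_add_left_cancel_le)
  qed
  then show ?thesis using \<open>\<delta> > 0\<close> by blast
qed (auto intro!: exI[of _ 1])

text \<open>The arc length parametrization is meaningful because every length up to the total is attained:
  the length function is continuous, so the intermediate value theorem applies.\<close>

lemma curve_length_surj:
  fixes \<gamma> :: "real \<Rightarrow> 'a::metric_space"
  assumes cont: "continuous_on {a..b} \<gamma>" and fin: "curve_length \<gamma> a b < \<infinity>" and "a \<le> b"
    and s: "0 \<le> s" "ennreal s \<le> curve_length \<gamma> a b"
  shows "\<exists>t\<in>{a..b}. curve_length \<gamma> a t = ennreal s"
proof -
  define L where "L t = enn2real (curve_length \<gamma> a t)" for t
  have L: "curve_length \<gamma> a t = ennreal (L t)" if "t \<in> {a..b}" for t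
    using fin curve_length_mono[of a a t b \<gamma>] that unfolding L_def
    by (auto simp: top_unique less_top[symmetric] intro!: ennreal_enn2real[symmetric])
  have L0: "0 \<le> L t" for t by (simp add: L_def)
  have "continuous_on {a..b} L"
    unfolding continuous_on_iff
  proof (intro ballI allI impI)
    fix x e :: real assume x: "x \<in> {a..b}" and "0 < e"
    then obtain \<delta> where \<delta>: "\<delta> > 0" "\<And>y y'. a \<le> y \<Longrightarrow> y \<le> y' \<Longrightarrow> y' \<le> b \<Longrightarrow> y' - y < \<delta> \<Longrightarrow>
        curve_length \<gamma> y y' \<le> ennreal (e / 2)"
      using curve_length_short[OF cont fin, of "e / 2"] by auto
    have close: "\<bar>L y' - L y\<bar> < e" if y: "a \<le> y" "y \<le> y'" "y' \<le> b" "y' - y < \<delta>" for y y'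
    proof -
      have "ennreal (L y') \<le> ennreal (L y) + ennreal (e / 2)"
        using curve_length_add[of a y y' \<gamma>] L[of y] L[of y'] y \<delta>(2)[of y y'] by auto
      moreover have "ennreal (L y) \<le> ennreal (L y')"
        using curve_length_mono[of a a y y' \<gamma>] L[of y] L[of y'] y by auto
      ultimately have "L y' \<le> L y + e / 2" "L y \<le> L y'"
        using L0 \<open>0 < e\<close> by (simp_all add: ennreal_plus[symmetric] ennreal_le_iff del: ennreal_plus)
      then show ?thesis using \<open>0 < e\<close> by linarith
    qed
    show "\<exists>d>0. \<forall>x'\<in>{a..b}. dist x' x < d \<longrightarrow> dist (L x') (L x) < e"
    proof (intro exI[of _ \<delta>] conjI ballI impI)
      fix x' assume "x' \<in> {a..b}" "dist x' x < \<delta>"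
      then show "dist (L x') (L x) < e"
        using close[of x x'] close[of x' x] x by (cases "x \<le> x'") (auto simp: dist_real_def abs_minus_commute)
    qed (use \<delta> in auto)
  qed
  moreover have "L a \<le> s"
  proof -
    have "curve_length \<gamma> a a = 0"
      using curve_length_add[of a a b \<gamma>] fin \<open>a \<le> b\<close>
      by (cases "curve_length \<gamma> a a"; cases "curve_length \<gamma> a b")
         (auto simp: ennreal_plus[symmetric] simp del: ennreal_plus)
    then show ?thesis using s by (simp add: L_def)
  qed
  moreover have "s \<le> L b"
    using s L[of b] \<open>a \<le> b\<close> L0 by (simp add: ennreal_le_iff)
  ultimately obtain t where "t \<in> {a..b}" "L t = s"
    using IVT'[of L a s b] \<open>a \<le> b\<close> by force
  then show ?thesis using L by blast
qed

text \<open>Two parameters with the same length are joined by a piece of length zero, on which \<open>\<gamma>\<close> is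
  constant; so the choice made in the definition is immaterial.\<close>

lemma arc_length_param_eq:
  assumes "t \<in> {a..b}" "curve_length \<gamma> a t = ennreal s"
  shows "arc_length_param \<gamma> a b s = \<gamma> t"
proof -
  define t' where "t' = (SOME t. t \<in> {a..b} \<and> curve_length \<gamma> a t = ennreal s)"
  have t': "t' \<in> {a..b} \<and> curve_length \<gamma> a t' = ennreal s"
    unfolding t'_def by (rule someI[of _ t]) (use assms in auto)
  have *: "\<gamma> x = \<gamma> y" if "a \<le> x" "x \<le> y" "curve_length \<gamma> a x = ennreal s" "curve_length \<gamma> a y = ennreal s" for x y
  proof -
    have "ennreal s + ennreal (dist (\<gamma> x) (\<gamma> y)) \<le> ennreal s + 0"
      using add_left_mono[OF curve_length_ge_dist[of x y \<gamma>], of "ennreal s"]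
        curve_length_add[of a x y \<gamma>] that by simp
    then have "ennreal (dist (\<gamma> x) (\<gamma> y)) \<le> 0"
      unfolding ennreal_add_left_cancel_le by simp
    then show ?thesis by simp
  qed
  have "\<gamma> t' = \<gamma> t"
    using *[OF _ _ assms(2) conjunct2[OF t']] *[OF _ _ conjunct2[OF t'] assms(2)] t' assms(1)
    by (metis atLeastAtMost_iff linear)
  then show ?thesis by (simp add: arc_length_param_def t'_def)
qed

text \<open>The arc length parametrization of a subpath is a translate of that of the whole path, by the
  length of the part that precedes the subpath.\<close>

lemma arc_length_param_subpath:
  fixes \<gamma> :: "real \<Rightarrow> 'a::metric_space"
  assumes cont: "continuous_on {a..b} \<gamma>" and fin: "curve_length \<gamma> a b < \<infinity>"
    and st: "a \<le> s" "s \<le> t" "t \<le> b"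
    and \<sigma>: "0 \<le> \<sigma>" "ennreal \<sigma> \<le> curve_length \<gamma> s t"
  obtains \<tau> where "\<tau> \<in> {s..t}" "arc_length_param \<gamma> s t \<sigma> = \<gamma> \<tau>"
    "arc_length_param \<gamma> a b (enn2real (curve_length \<gamma> a s) + \<sigma>) = \<gamma> \<tau>"
proof -
  have "curve_length \<gamma> s t < \<infinity>"
    using curve_length_mono[OF st, of \<gamma>] fin by (rule le_less_trans)
  moreover have "continuous_on {s..t} \<gamma>"
    using cont st by (auto intro: continuous_on_subset)
  ultimately obtain \<tau> where \<tau>: "\<tau> \<in> {s..t}" "curve_length \<gamma> s \<tau> = ennreal \<sigma>"
    using curve_length_surj[of s t \<gamma> \<sigma>] st \<sigma> by auto
  have "curve_length \<gamma> a s < top"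
    using curve_length_mono[of a a s b \<gamma>] fin st by (auto simp: top_unique less_top[symmetric])
  then have "curve_length \<gamma> a \<tau> = ennreal (enn2real (curve_length \<gamma> a s) + \<sigma>)"
    using curve_length_add[of a s \<tau> \<gamma>] \<tau> st \<sigma> by simp
  then show ?thesis
    using \<tau> st by (intro that[of \<tau>] arc_length_param_eq) auto
qed

section \<open>Path integrals over subpaths\<close>

text \<open>For an arbitrary function \<open>f\<close> the integral is the supremum of the integrals of the simple functions
  below \<open>f\<close>; multiplied by \<open>c\<close>, these are simple functions below \<open>c * f\<close>.\<close>

lemma nn_integral_cmult_ge:
  "c * (\<integral>\<^sup>+x. f x \<partial>M) \<le> (\<integral>\<^sup>+x. c * f x \<partial>M)"
proof -
  have "c * (\<integral>\<^sup>+x. f x \<partial>M) = (SUP g \<in> {g. simple_function M g \<and> g \<le> f}. c * integral\<^sup>S M g)"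
    unfolding nn_integral_def by (rule SUP_mult_left_ennreal)
  also have "\<dots> \<le> (\<integral>\<^sup>+x. c * f x \<partial>M)"
  proof (rule SUP_least)
    fix g assume "g \<in> {g. simple_function M g \<and> g \<le> f}"
    then have g: "simple_function M g" "\<And>x. g x \<le> f x" by (auto simp: le_fun_def)
    have "c * integral\<^sup>S M g = (\<integral>\<^sup>+x. c * g x \<partial>M)"
      using g(1) by (simp add: nn_integral_eq_simple_integral nn_integral_cmult borel_measurable_simple_function)
    also have "\<dots> \<le> (\<integral>\<^sup>+x. c * f x \<partial>M)"
      using g(2) by (intro nn_integral_mono mult_left_mono) auto
    finally show "c * integral\<^sup>S M g \<le> (\<integral>\<^sup>+x. c * f x \<partial>M)" .
  qed
  finally show ?thesis .
qed

text \<open>Translation takes simple functions below the left integrand to simple functions below \<open>f\<close>, with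
  the same integral.\<close>

lemma nn_integral_lborel_shift_le:
  fixes f :: "real \<Rightarrow> ennreal"
  shows "(\<integral>\<^sup>+x. f (c + x) \<partial>lborel) \<le> (\<integral>\<^sup>+x. f x \<partial>lborel)"
  unfolding nn_integral_def[of lborel "\<lambda>x. f (c + x)"]
proof (rule SUP_least)
  fix g assume "g \<in> {g. simple_function lborel g \<and> g \<le> (\<lambda>x. f (c + x))}"
  then have g: "simple_function lborel g" "\<And>x. g x \<le> f (c + x)" by (auto simp: le_fun_def)
  have [measurable]: "g \<in> borel_measurable borel"
    using borel_measurable_simple_function[OF g(1)] by simp
  have "integral\<^sup>S lborel g = (\<integral>\<^sup>+x. g x \<partial>lborel)"
    using g(1) by (simp add: nn_integral_eq_simple_integral)
  also have "\<dots> = (\<integral>\<^sup>+x. g x \<partial>distr lborel borel ((+) (- c)))"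
    by (simp add: lborel_distr_plus)
  also have "\<dots> = (\<integral>\<^sup>+x. g (- c + x) \<partial>lborel)"
    by (subst nn_integral_distr) auto
  also have "\<dots> \<le> (\<integral>\<^sup>+x. f x \<partial>lborel)"
    using g(2)[of "- c + _"] by (intro nn_integral_mono) auto
  finally show "integral\<^sup>S lborel g \<le> (\<integral>\<^sup>+x. f x \<partial>lborel)" .
qed

text \<open>The hypothesis on \<open>\<rho>'\<close> concerns the points of the subpath only.  With \<open>\<rho>' = \<rho>\<close> this is
  monotonicity under restriction to a subpath; the general form compares a gradient with its
  restriction to a level band in which the subpath runs.\<close>

lemma path_integral_subpath_le:
  assumes cont: "continuous_on {a..b} \<gamma>" and fin: "curve_length \<gamma> a b < \<infinity>"
    and st: "a \<le> s" "s \<le> t" "t \<le> b"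
    and le: "\<And>\<tau>. \<tau> \<in> {s..t} \<Longrightarrow> \<rho>' (\<gamma> \<tau>) \<le> \<rho> (\<gamma> \<tau>)"
  shows "path_integral \<rho>' (s, t, \<gamma>) \<le> path_integral \<rho> (a, b, \<gamma>)"
proof -
  let ?l = "enn2real (curve_length \<gamma> a s)"
  let ?f = "\<lambda>\<sigma>. \<rho> (arc_length_param \<gamma> a b \<sigma>) * indicator {0..enn2real (curve_length \<gamma> a b)} \<sigma>"
  have finite: "curve_length \<gamma> a s < top" "curve_length \<gamma> s t < top"
    using curve_length_mono[of a a s b \<gamma>] curve_length_mono[of a s t b \<gamma>] fin st
    by (auto simp: top_unique less_top[symmetric])
  have "curve_length \<gamma> a s + curve_length \<gamma> s t \<le> curve_length \<gamma> a b"
    using curve_length_mono[of a a t b \<gamma>] curve_length_add[of a s t \<gamma>] st by simp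
  then have len: "?l + enn2real (curve_length \<gamma> s t) \<le> enn2real (curve_length \<gamma> a b)"
    using fin finite enn2real_mono[of "curve_length \<gamma> a s + curve_length \<gamma> s t" "curve_length \<gamma> a b"]
    by (simp add: enn2real_plus)
  have "path_integral \<rho>' (s, t, \<gamma>) \<le> (\<integral>\<^sup>+\<sigma>. ?f (?l + \<sigma>) \<partial>lborel)"
    unfolding path_integral_def prod.case
  proof (rule nn_integral_mono)
    fix \<sigma> :: real
    show "\<rho>' (arc_length_param \<gamma> s t \<sigma>) * indicator {0..enn2real (curve_length \<gamma> s t)} \<sigma> \<le> ?f (?l + \<sigma>)"
    proof (cases "\<sigma> \<in> {0..enn2real (curve_length \<gamma> s t)}")
      case True
      then have "ennreal \<sigma> \<le> curve_length \<gamma> s t"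
        using finite ennreal_leI[of \<sigma> "enn2real (curve_length \<gamma> s t)"] by simp
      then obtain \<tau> where "\<tau> \<in> {s..t}" "arc_length_param \<gamma> s t \<sigma> = \<gamma> \<tau>"
          "arc_length_param \<gamma> a b (?l + \<sigma>) = \<gamma> \<tau>"
        using arc_length_param_subpath[OF cont fin st, of \<sigma>] True by auto
      moreover have "?l + \<sigma> \<in> {0..enn2real (curve_length \<gamma> a b)}"
        using True len by auto
      ultimately show ?thesis using True le by simp
    qed simp
  qed
  also have "\<dots> \<le> path_integral \<rho> (a, b, \<gamma>)"
    unfolding path_integral_def prod.case by (rule nn_integral_lborel_shift_le)
  finally show ?thesis .
qed

section \<open>Truncation of functions with a weak upper gradient\<close>

text \<open>Take for \<open>t\<close> the first time at which \<open>f\<close> reaches \<open>\<beta>\<close>, and for \<open>s\<close> the last time before \<open>t\<close> at which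
  \<open>f\<close> is at most \<open>\<alpha>\<close>.\<close>

lemma obtain_level_crossing:
  fixes f :: "real \<Rightarrow> real"
  assumes cont: "continuous_on {a..b} f" and "a \<le> b" "f a \<le> \<alpha>" "\<alpha> < \<beta>" "\<beta> \<le> f b"
  obtains s t where "a \<le> s" "s \<le> t" "t \<le> b" "f s = \<alpha>" "f t = \<beta>"
    "\<And>\<tau>. \<tau> \<in> {s..t} \<Longrightarrow> \<alpha> \<le> f \<tau> \<and> f \<tau> \<le> \<beta>"
proof -
  have cont': "continuous_on {x..y} f" if "a \<le> x" "y \<le> b" for x y
    using cont by (rule continuous_on_subset) (use that in auto)
  have compact: "compact {\<tau> \<in> {x..y}. f \<tau> \<in> B}" if "a \<le> x" "y \<le> b" "closed B" for x y B
  proof -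
    have "closed ({x..y} \<inter> f -` B)"
      using that by (intro continuous_closed_preimage cont') auto
    then have "compact ({x..y} \<inter> ({x..y} \<inter> f -` B))"
      by (rule compact_Int_closed[OF compact_Icc])
    then show ?thesis by (simp add: Int_def vimage_def conj_ac)
  qed
  have "compact {x \<in> {a..b}. \<beta> \<le> f x}"
    using compact[of a b "{\<beta>..}"] by simp
  then obtain t where t: "t \<in> {a..b}" "\<beta> \<le> f t" "\<And>x. x \<in> {a..b} \<Longrightarrow> \<beta> \<le> f x \<Longrightarrow> t \<le> x"
    using compact_attains_inf[of "{x \<in> {a..b}. \<beta> \<le> f x}"] assms by auto
  have ft: "f t = \<beta>"
  proof -
    obtain x where "a \<le> x" "x \<le> t" "f x = \<beta>"
      using IVT'[of f a \<beta> t] t assms cont'[of a t] by auto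
    then show ?thesis using t(1) t(3)[of x] by auto
  qed
  have "compact {x \<in> {a..t}. f x \<le> \<alpha>}"
    using compact[of a t "{..\<alpha>}"] t by simp
  then obtain s where s: "s \<in> {a..t}" "f s \<le> \<alpha>" "\<And>x. x \<in> {a..t} \<Longrightarrow> f x \<le> \<alpha> \<Longrightarrow> x \<le> s"
    using compact_attains_sup[of "{x \<in> {a..t}. f x \<le> \<alpha>}"] t assms by auto
  have fs: "f s = \<alpha>"
  proof -
    obtain x where "s \<le> x" "x \<le> t" "f x = \<alpha>"
      using IVT'[of f s \<alpha> t] s t ft assms cont'[of s t] by auto
    then show ?thesis using s(1) s(3)[of x] by auto
  qed
  show ?thesis
  proof (rule that[of s t])
    fix \<tau> assume \<tau>: "\<tau> \<in> {s..t}"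
    show "\<alpha> \<le> f \<tau> \<and> f \<tau> \<le> \<beta>"
      using s(3)[of \<tau>] t(3)[of \<tau>] \<tau> s(1) t(1) fs ft by (cases "\<tau> = s \<or> \<tau> = t") (use assms in force)+
  qed (use s t fs ft in auto)
qed

text \<open>The oscillation of the truncation is realized by \<open>f\<close> itself on a subinterval in which \<open>f\<close> stays
  in the band \<open>[l, h]\<close>.  If \<open>f b < f a\<close>, the previous lemma is applied to \<open>- f\<close>.\<close>

lemma obtain_truncation_crossing:
  fixes f :: "real \<Rightarrow> real"
  assumes cont: "continuous_on {a..b} f" and "a \<le> b"
    and ne: "max l (min h (f a)) \<noteq> max l (min h (f b))"
  obtains s t where "a \<le> s" "s \<le> t" "t \<le> b"
    "\<bar>f s - f t\<bar> = \<bar>max l (min h (f a)) - max l (min h (f b))\<bar>"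
    "\<And>\<tau>. \<tau> \<in> {s..t} \<Longrightarrow> l \<le> f \<tau> \<and> f \<tau> \<le> h"
proof -
  obtain \<alpha> \<beta> where \<alpha>: "\<alpha> = max l (min h (f a))" and \<beta>: "\<beta> = max l (min h (f b))"
    by blast
  show ?thesis
  proof (cases "f a < f b")
    case True
    have *: "f a \<le> \<alpha>" "\<alpha> < \<beta>" "\<beta> \<le> f b" "l \<le> \<alpha>" "\<beta> \<le> h"
      using ne True by (auto simp: \<alpha> \<beta> min_def max_def split: if_splits)
    obtain s t where st: "a \<le> s" "s \<le> t" "t \<le> b" "f s = \<alpha>" "f t = \<beta>"
       and between: "\<And>\<tau>. \<tau> \<in> {s..t} \<Longrightarrow> \<alpha> \<le> f \<tau> \<and> f \<tau> \<le> \<beta>"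
      using obtain_level_crossing[OF cont \<open>a \<le> b\<close> *(1-3)] by blast
    show ?thesis
    proof (rule that[OF st(1-3)])
      show "l \<le> f \<tau> \<and> f \<tau> \<le> h" if "\<tau> \<in> {s..t}" for \<tau>
        using between[OF that] *(4,5) by linarith
    qed (use st(4,5) in \<open>simp add: \<alpha> \<beta>\<close>)
  next
    case False
    then have "f b < f a" using ne by (cases "f a = f b") auto
    then have *: "- f a \<le> - \<alpha>" "- \<alpha> < - \<beta>" "- \<beta> \<le> - f b" "l \<le> \<beta>" "\<alpha> \<le> h"
      using ne by (auto simp: \<alpha> \<beta> min_def max_def split: if_splits)
    obtain s t where st: "a \<le> s" "s \<le> t" "t \<le> b" "- f s = - \<alpha>" "- f t = - \<beta>"
       and between: "\<And>\<tau>. \<tau> \<in> {s..t} \<Longrightarrow> - \<alpha> \<le> - f \<tau> \<and> - f \<tau> \<le> - \<beta>"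
      using obtain_level_crossing[OF continuous_on_minus[OF cont] \<open>a \<le> b\<close> *(1-3)] by blast
    show ?thesis
    proof (rule that[OF st(1-3)])
      show "l \<le> f \<tau> \<and> f \<tau> \<le> h" if "\<tau> \<in> {s..t}" for \<tau>
        using between[OF that] *(4,5) by linarith
    qed (use st(4,5) in \<open>simp add: \<alpha> \<beta>\<close>)
  qed
qed

lemma weak_upper_gradient_real_iff:
  "weak_upper_gradient \<mu> \<Omega> p (\<lambda>x. ereal (u x)) g \<longleftrightarrow>
     g \<in> borel_measurable (restrict_space (caratheodory_measure \<mu>) \<Omega>) \<and>
     almost_every_path \<mu> \<Omega> p (\<lambda>(a, b, \<gamma>). ennreal \<bar>u (\<gamma> a) - u (\<gamma> b)\<bar> \<le> path_integral g (a, b, \<gamma>))"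
  unfolding weak_upper_gradient_def by (simp add: e2ennreal_ereal)

lemma weak_upper_gradient_same_oscillation:
  assumes "weak_upper_gradient \<mu> \<Omega> p (\<lambda>x. ereal (u x)) g"
    and "\<And>x y. \<bar>v x - v y\<bar> = \<bar>u x - u y\<bar>"
  shows "weak_upper_gradient \<mu> \<Omega> p (\<lambda>x. ereal (v x)) g"
  using assms by (simp add: weak_upper_gradient_real_iff)

lemma sets_borel_le_caratheodory:
  assumes "borel_regular_outer_measure \<mu>"
  shows "sets borel \<subseteq> sets (caratheodory_measure \<mu>)"
  using assms sets_caratheodory_measure[OF assms] by (simp add: borel_regular_outer_measure_def)

lemma space_caratheodory [simp]: "space (caratheodory_measure \<mu>) = UNIV"
  by (simp add: caratheodory_measure_def space_measure_of_conv)

lemma borel_measurable_caratheodory_continuous: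
  assumes "borel_regular_outer_measure \<mu>" "continuous_on \<Omega> (u :: _ \<Rightarrow> real)"
  shows "u \<in> borel_measurable (restrict_space (caratheodory_measure \<mu>) \<Omega>)"
proof (rule measurableI)
  fix B :: "real set" assume "B \<in> sets borel"
  then have "u -` B \<inter> space (restrict_space borel \<Omega>) \<in> sets (restrict_space borel \<Omega>)"
    using borel_measurable_continuous_on_restrict[OF assms(2)] by (rule measurable_sets[rotated])
  then show "u -` B \<inter> space (restrict_space (caratheodory_measure \<mu>) \<Omega>)
      \<in> sets (restrict_space (caratheodory_measure \<mu>) \<Omega>)"
    using sets_borel_le_caratheodory[OF assms(1)]
    by (auto simp: sets_restrict_space space_restrict_space)
qed simp

text \<open>The weak upper gradient of a truncation may be cut off outside of the level band.  If the
  inequality for the truncation fails along a path, then by the crossing lemma the one for \<open>u\<close>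
  fails along a subpath in the band.  A function \<open>\<rho>\<close> whose integral is infinite along every exceptional
  path of \<open>u\<close> has infinite integral over that subpath, hence over the whole path; so \<open>\<rho>\<close> also
  witnesses that the exceptional family of the truncation has zero modulus.\<close>

lemma weak_upper_gradient_truncation:
  fixes u :: "'a::metric_space \<Rightarrow> real"
  assumes \<mu>: "borel_regular_outer_measure \<mu>"
    and cont: "continuous_on \<Omega> u"
    and g: "weak_upper_gradient \<mu> \<Omega> p (\<lambda>x. ereal (u x)) g"
    and "0 \<le> c"
  shows "weak_upper_gradient \<mu> \<Omega> p (\<lambda>x. ereal (c * max l (min h (u x)) + d))
           (\<lambda>x. if l \<le> u x \<and> u x \<le> h then ennreal c * g x else 0)"
    (is "weak_upper_gradient \<mu> \<Omega> p (\<lambda>x. ereal (?w x)) ?g")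
  unfolding weak_upper_gradient_real_iff
proof
  have [measurable]: "g \<in> borel_measurable (restrict_space (caratheodory_measure \<mu>) \<Omega>)"
    using g by (simp add: weak_upper_gradient_def)
  have [measurable]: "u \<in> borel_measurable (restrict_space (caratheodory_measure \<mu>) \<Omega>)"
    using \<mu> cont by (rule borel_measurable_caratheodory_continuous)
  show "?g \<in> borel_measurable (restrict_space (caratheodory_measure \<mu>) \<Omega>)"
    by measurable
  obtain \<rho> :: "'a \<Rightarrow> ennreal" where \<rho>: "\<rho> \<in> borel_measurable (restrict_space borel \<Omega>)"
      "(\<integral>\<^sup>+ x\<in>\<Omega>. epowr (\<rho> x) p \<partial>caratheodory_measure \<mu>) < \<infinity>"
    and bad: "\<And>a b \<gamma>. (a, b, \<gamma>) \<in> paths_in \<Omega> \<Longrightarrow>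
        \<not> ennreal \<bar>u (\<gamma> a) - u (\<gamma> b)\<bar> \<le> path_integral g (a, b, \<gamma>) \<Longrightarrow> path_integral \<rho> (a, b, \<gamma>) = \<infinity>"
    using g unfolding weak_upper_gradient_real_iff almost_every_path_def zero_modulus_def by auto
  have "path_integral \<rho> (a, b, \<gamma>) = \<infinity>"
    if path: "(a, b, \<gamma>) \<in> paths_in \<Omega>"
      and fails: "\<not> ennreal \<bar>?w (\<gamma> a) - ?w (\<gamma> b)\<bar> \<le> path_integral ?g (a, b, \<gamma>)" for a b \<gamma>
  proof -
    have ab: "a \<le> b" "continuous_on {a..b} \<gamma>" "\<gamma> ` {a..b} \<subseteq> \<Omega>" "curve_length \<gamma> a b < \<infinity>"
      using path by (auto simp: paths_in_def)
    have contf: "continuous_on {a..b} (\<lambda>t. u (\<gamma> t))"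
      using continuous_on_compose2[OF cont ab(2)] ab(3) by auto
    have "max l (min h (u (\<gamma> a))) \<noteq> max l (min h (u (\<gamma> b)))"
      using fails by auto
    then obtain s t where st: "a \<le> s" "s \<le> t" "t \<le> b"
        and osc: "\<bar>u (\<gamma> s) - u (\<gamma> t)\<bar> = \<bar>max l (min h (u (\<gamma> a))) - max l (min h (u (\<gamma> b)))\<bar>"
        and between: "\<And>\<tau>. \<tau> \<in> {s..t} \<Longrightarrow> l \<le> u (\<gamma> \<tau>) \<and> u (\<gamma> \<tau>) \<le> h"
      using obtain_truncation_crossing[OF contf ab(1)] by blast
    have "u (\<gamma> s) \<noteq> u (\<gamma> t)"
      using osc \<open>max l (min h (u (\<gamma> a))) \<noteq> max l (min h (u (\<gamma> b)))\<close>
      by (metis abs_eq_0 eq_iff_diff_eq_0)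
    then have "\<not> \<gamma> constant_on {s..t}"
      using st unfolding constant_on_def
      by (metis atLeastAtMost_iff order_refl)
    moreover have "curve_length \<gamma> s t < \<infinity>"
      using curve_length_mono[OF st, of \<gamma>] ab(4) by (rule le_less_trans)
    moreover have "continuous_on {s..t} \<gamma>"
      using ab(2) by (rule continuous_on_subset) (use st in auto)
    ultimately have sub: "(s, t, \<gamma>) \<in> paths_in \<Omega>"
      using ab(3) st by (auto simp: paths_in_def image_subset_iff)
    have eq: "ennreal \<bar>?w (\<gamma> a) - ?w (\<gamma> b)\<bar> = ennreal c * ennreal \<bar>u (\<gamma> s) - u (\<gamma> t)\<bar>"
      unfolding osc using \<open>0 \<le> c\<close>
      by (simp add: ennreal_mult[symmetric] abs_mult flip: right_diff_distrib)
    have "ennreal c * path_integral g (s, t, \<gamma>) \<le> path_integral (\<lambda>x. ennreal c * g x) (s, t, \<gamma>)"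
      unfolding path_integral_def prod.case mult.assoc by (rule nn_integral_cmult_ge)
    also have "path_integral (\<lambda>x. ennreal c * g x) (s, t, \<gamma>) \<le> path_integral ?g (a, b, \<gamma>)"
      using between by (intro path_integral_subpath_le ab st) simp
    finally have "\<not> ennreal \<bar>u (\<gamma> s) - u (\<gamma> t)\<bar> \<le> path_integral g (s, t, \<gamma>)"
      using fails unfolding eq
      by (auto dest: mult_left_mono[where c = "ennreal c"] order_trans)
    then have "path_integral \<rho> (s, t, \<gamma>) = \<infinity>"
      using bad sub by blast
    moreover have "path_integral \<rho> (s, t, \<gamma>) \<le> path_integral \<rho> (a, b, \<gamma>)"
      by (intro path_integral_subpath_le ab st order_refl)
    ultimately show ?thesis by (simp add: top_unique)
  qed
  then show "almost_every_path \<mu> \<Omega> p (\<lambda>(a, b, \<gamma>). ennreal \<bar>?w (\<gamma> a) - ?w (\<gamma> b)\<bar> \<le> path_integral ?g (a, b, \<gamma>))"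
    unfolding almost_every_path_def zero_modulus_def using \<rho> by (intro exI[of _ \<rho>]) auto
qed

section \<open>Bounded functions and finiteness\<close>

lemma emeasure_caratheodory_borel:
  assumes "borel_regular_outer_measure \<mu>" "A \<in> sets borel"
  shows "emeasure (caratheodory_measure \<mu>) A = \<mu> A"
  using assms sets_borel_le_caratheodory[of \<mu>] by (intro emeasure_caratheodory_measure) auto

lemma bounded_finite_outer_measure:
  fixes \<mu> :: "'a::metric_space set \<Rightarrow> ennreal"
  assumes \<mu>: "borel_regular_outer_measure \<mu>" and ball: "\<And>x r. 0 < r \<Longrightarrow> \<mu> (ball x r) < \<infinity>"
    and \<Omega>: "bounded \<Omega>" "open \<Omega>"
  shows "\<mu> \<Omega> < \<infinity>"
proof -
  obtain x r where "0 < r" "\<Omega> \<subseteq> ball (x :: 'a) r"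
    using bounded_subset_ballD[OF \<Omega>(1)] by blast
  then have "emeasure (caratheodory_measure \<mu>) \<Omega> \<le> emeasure (caratheodory_measure \<mu>) (ball x r)"
    using sets_borel_le_caratheodory[OF \<mu>] by (intro emeasure_mono) auto
  then show ?thesis
    using ball[OF \<open>0 < r\<close>, of x] \<Omega>(2) by (simp add: emeasure_caratheodory_borel[OF \<mu>] order_le_less_trans)
qed

lemma bounded_newtonian_continuousI:
  assumes \<mu>: "borel_regular_outer_measure \<mu>" and \<Omega>: "\<Omega> \<in> sets borel" "\<mu> \<Omega> < \<infinity>"
    and u: "continuous_on \<Omega> u" "\<And>x. x \<in> \<Omega> \<Longrightarrow> \<bar>u x\<bar> \<le> K" and p: "0 < p"
    and g: "weak_upper_gradient \<mu> \<Omega> p (\<lambda>x. ereal (u x)) g"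
      "(\<integral>\<^sup>+ x\<in>\<Omega>. epowr (g x) p \<partial>caratheodory_measure \<mu>) < \<infinity>"
  shows "u \<in> newtonian_continuous \<mu> \<Omega> p"
proof -
  let ?M = "caratheodory_measure \<mu>"
  have "(\<integral>\<^sup>+ x\<in>\<Omega>. epowr (e2ennreal \<bar>ereal (u x)\<bar>) p \<partial>?M) \<le> (\<integral>\<^sup>+ x. ennreal (K powr p) * indicator \<Omega> x \<partial>?M)"
    using u(2) p
    by (intro nn_integral_mono)
       (auto simp: indicator_def e2ennreal_ereal epowr_ennreal intro!: ennreal_leI powr_mono2)
  also have "\<dots> = ennreal (K powr p) * \<mu> \<Omega>"
    using \<Omega>(1) sets_borel_le_caratheodory[OF \<mu>]
    by (subst nn_integral_cmult_indicator) (auto simp: emeasure_caratheodory_borel[OF \<mu>])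
  also have "\<dots> < \<infinity>"
    using \<Omega>(2) by (simp add: ennreal_mult_less_top)
  finally have "(\<integral>\<^sup>+ x\<in>\<Omega>. epowr (e2ennreal \<bar>ereal (u x)\<bar>) p \<partial>?M) < \<infinity>" .
  moreover have "(INF g \<in> {g. weak_upper_gradient \<mu> \<Omega> p (\<lambda>x. ereal (u x)) g}. \<integral>\<^sup>+ x\<in>\<Omega>. epowr (g x) p \<partial>?M) < \<infinity>"
    using g(2) by (rule le_less_trans[rotated], intro INF_lower) (use g(1) in simp)
  ultimately have "newtonian_norm \<mu> \<Omega> p (\<lambda>x. ereal (u x)) < \<infinity>"
    unfolding newtonian_norm_def by (simp add: epowr_less_top_iff)
  moreover have "(\<lambda>x. ereal (u x)) \<in> borel_measurable (restrict_space ?M \<Omega>)"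
    using borel_measurable_caratheodory_continuous[OF \<mu> u(1)] by measurable
  ultimately show ?thesis
    using u(1) by (simp add: newtonian_continuous_def newtonian_def)
qed

lemma weak_upper_gradient_const:
  "weak_upper_gradient \<mu> \<Omega> p (\<lambda>x. ereal c) (\<lambda>x. 0)"
  unfolding weak_upper_gradient_real_iff almost_every_path_def zero_modulus_def
  by (auto intro!: exI[of _ "\<lambda>_. 0"])

text \<open>If \<open>\<nu> \<Omega> = \<infinity>\<close>, then \<open>\<nu> \<Omega> \<le> \<nu> \<Omega> / 2\<close>, so the conductor inequality applies to \<open>F = G = \<Omega>\<close>.  The
  constant function \<open>1\<close> has finite norm, since \<open>\<mu> \<Omega> < \<infinity>\<close>, and shows that the conductivity is zero:
  a contradiction.\<close>

lemma finite_of_conductor_inequality: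
  fixes \<mu> \<nu> :: "'a::metric_space set \<Rightarrow> ennreal"
  assumes \<mu>: "borel_regular_outer_measure \<mu>" and \<Omega>: "open \<Omega>" "\<mu> \<Omega> < \<infinity>" and p: "0 < p"
    and ineq: "\<And>F G. conductor \<Omega> F G \<Longrightarrow> \<nu> G \<le> \<nu> \<Omega> / 2 \<Longrightarrow>
            epowr (\<nu> F) r \<le> ennreal \<gamma> * conductivity \<mu> p F G \<Omega>"
  shows "\<nu> \<Omega> < \<infinity>"
proof (rule ccontr)
  assume "\<not> \<nu> \<Omega> < \<infinity>"
  then have top: "\<nu> \<Omega> = top" by (simp add: less_top[symmetric])
  have "(\<lambda>x. 1) \<in> newtonian_continuous \<mu> \<Omega> p"
    by (rule bounded_newtonian_continuousI[OF \<mu>, where g = "\<lambda>_. 0" and K = 1])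
       (use \<Omega> p weak_upper_gradient_const[of \<mu> \<Omega> p 1] in auto)
  then have "(\<lambda>x. 1) \<in> conductor_admissible \<mu> p \<Omega> \<Omega> \<Omega>"
    by (simp add: conductor_admissible_def)
  then have "conductivity \<mu> p \<Omega> \<Omega> \<Omega> \<le> (\<integral>\<^sup>+ x\<in>\<Omega>. epowr 0 p \<partial>caratheodory_measure \<mu>)"
    unfolding conductivity_def
    by (rule INF_lower2, intro INF_lower2[of "\<lambda>_. 0"]) (use weak_upper_gradient_const[of \<mu> \<Omega> p 1] in auto)
  then have "conductivity \<mu> p \<Omega> \<Omega> \<Omega> = 0" by simp
  moreover have "conductor \<Omega> \<Omega> \<Omega>" using \<Omega> by (simp add: conductor_def)
  ultimately show False
    using ineq[of \<Omega> \<Omega>] top by (simp add: ennreal_top_divide)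
qed

section \<open>Medians\<close>

text \<open>The infimum \<open>m\<close> of all \<open>t\<close> with \<open>measure M {f > t} \<le> measure M (space M) / 2\<close> is a median.  It is finite because
  the measure of \<open>{f > t}\<close> tends to zero as \<open>t \<rightarrow> \<infinity>\<close> and to the total measure as \<open>t \<rightarrow> - \<infinity>\<close>; both
  inequalities follow by continuity from below.\<close>

lemma (in finite_measure) obtain_median:
  fixes f :: "'a \<Rightarrow> real"
  assumes [measurable]: "f \<in> borel_measurable M"
  obtains m where "measure M {x \<in> space M. m < f x} \<le> measure M (space M) / 2"
    "measure M {x \<in> space M. f x < m} \<le> measure M (space M) / 2"
proof (cases "measure M (space M) = 0")
  case True
  then have "measure M A \<le> measure M (space M) / 2" for A
    using bounded_measure[of A] by simp
  then show ?thesis using that by blast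
next
  case False
  define S where "S = measure M (space M)"
  have S: "0 < S" using False by (simp add: S_def zero_less_measure_iff)
  define above where "above t = measure M {x \<in> space M. t < f x}" for t
  have above_mono: "above t \<le> above s" if "s \<le> t" for s t
    unfolding above_def using that by (intro finite_measure_mono) auto
  define T where "T = {t. above t \<le> S / 2}"
  have "(\<lambda>n. above (real n)) \<longlonglongrightarrow> measure M (\<Inter>n. {x \<in> space M. real n < f x})"
    unfolding above_def by (rule finite_Lim_measure_decseq) (auto simp: decseq_def)
  also have "(\<Inter>n. {x \<in> space M. real n < f x}) = {}"
    using reals_Archimedean2[of "f _"] by (auto dest: less_asym)
  finally have "\<forall>\<^sub>F n in sequentially. above (real n) < S / 2"
    using S by (intro order_tendstoD) auto
  then obtain n where "above (real n) < S / 2" by (auto simp: eventually_sequentially)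
  then have ne: "T \<noteq> {}" by (auto simp: T_def intro!: exI[of _ "real n"])
  have "(\<lambda>n. above (- real n)) \<longlonglongrightarrow> measure M (\<Union>n. {x \<in> space M. - real n < f x})"
    unfolding above_def by (rule finite_Lim_measure_incseq) (auto simp: incseq_def)
  also have "(\<Union>n. {x \<in> space M. - real n < f x}) = space M"
  proof -
    have "\<exists>n. - real n < f x" for x
      using reals_Archimedean2[of "- f x"] by (auto simp: minus_less_iff)
    then show ?thesis by auto
  qed
  finally have "\<forall>\<^sub>F n in sequentially. S / 2 < above (- real n)"
    using S by (intro order_tendstoD) (auto simp: S_def)
  then obtain k where "S / 2 < above (- real k)" by (auto simp: eventually_sequentially)
  then have "- real k \<le> t" if "t \<in> T" for t
    using that above_mono[of t "- real k"] by (force simp: T_def)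
  then have bdd: "bdd_below T" by (auto simp: bdd_below_def)
  define m where "m = Inf T"
  have anti: "1 / real (Suc n) \<le> 1 / real (Suc k)" if "k \<le> n" for k n
    using that by (simp add: frac_le)
  show ?thesis
  proof (rule that[of m])
    have "(\<lambda>n. above (m + 1 / real (Suc n))) \<longlonglongrightarrow> measure M (\<Union>n. {x \<in> space M. m + 1 / real (Suc n) < f x})"
      unfolding above_def
      by (rule finite_Lim_measure_incseq)
         (use anti in \<open>force simp: incseq_def simp del: of_nat_Suc\<close>)+
    also have "(\<Union>n. {x \<in> space M. m + 1 / real (Suc n) < f x}) = {x \<in> space M. m < f x}"
    proof (safe)
      fix x n assume "m + 1 / real (Suc n) < f x"
      then show "m < f x" by (smt (verit) divide_pos_pos of_nat_0_less_iff zero_less_Suc)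
    next
      fix x assume "x \<in> space M" "m < f x"
      then obtain n where "inverse (real (Suc n)) < f x - m" using reals_Archimedean[of "f x - m"] by auto
      then show "x \<in> (\<Union>n. {x \<in> space M. m + 1 / real (Suc n) < f x})"
        using \<open>x \<in> space M\<close> by (auto simp: inverse_eq_divide intro!: exI[of _ n])
    qed
    finally show "measure M {x \<in> space M. m < f x} \<le> measure M (space M) / 2"
    proof (rule LIMSEQ_le_const2, intro exI allI impI)
      fix n
      have "Inf T < m + 1 / real (Suc n)" by (simp add: m_def)
      then obtain t where "t \<in> T" "t < m + 1 / real (Suc n)"
        using cInf_less_iff[OF ne bdd] by auto
      then show "above (m + 1 / real (Suc n)) \<le> measure M (space M) / 2"
        using above_mono[of t "m + 1 / real (Suc n)"] by (simp add: T_def S_def)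
    qed
  next
    have "(\<lambda>n. measure M {x \<in> space M. f x < m - 1 / real (Suc n)}) \<longlonglongrightarrow>
        measure M (\<Union>n. {x \<in> space M. f x < m - 1 / real (Suc n)})"
      by (rule finite_Lim_measure_incseq)
         (use anti in \<open>force simp: incseq_def simp del: of_nat_Suc\<close>)+
    also have "(\<Union>n. {x \<in> space M. f x < m - 1 / real (Suc n)}) = {x \<in> space M. f x < m}"
    proof (safe)
      fix x n assume "f x < m - 1 / real (Suc n)"
      then show "f x < m" by (smt (verit) divide_pos_pos of_nat_0_less_iff zero_less_Suc)
    next
      fix x assume "x \<in> space M" "f x < m"
      then obtain n where "inverse (real (Suc n)) < m - f x" using reals_Archimedean[of "m - f x"] by auto
      then show "x \<in> (\<Union>n. {x \<in> space M. f x < m - 1 / real (Suc n)})"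
        using \<open>x \<in> space M\<close> by (auto simp: inverse_eq_divide intro!: exI[of _ n])
    qed
    finally show "measure M {x \<in> space M. f x < m} \<le> measure M (space M) / 2"
    proof (rule LIMSEQ_le_const2, intro exI allI impI)
      fix n
      define t where "t = m - 1 / real (Suc n)"
      have "t < m" by (simp add: t_def)
      then have "t \<notin> T" using cInf_lower[OF _ bdd, of t] by (auto simp: m_def)
      moreover have "measure M {x \<in> space M. f x < t} + above t
          = measure M ({x \<in> space M. f x < t} \<union> {x \<in> space M. t < f x})"
        unfolding above_def by (rule finite_measure_Union[symmetric]) auto
      moreover have "\<dots> \<le> S"
        unfolding S_def by (rule bounded_measure)
      ultimately show "measure M {x \<in> space M. f x < m - 1 / real (Suc n)} \<le> measure M (space M) / 2"
        by (simp add: T_def S_def t_def)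
    qed
  qed
qed

section \<open>From the conductor inequality to the Poincare inequality\<close>

lemma set_nn_integral_restrict_space:
  assumes "borel_regular_outer_measure \<mu>" "open \<Omega>"
  shows "(\<integral>\<^sup>+ x\<in>\<Omega>. f x \<partial>caratheodory_measure \<mu>)
    = (\<integral>\<^sup>+ x. f x \<partial>restrict_space (caratheodory_measure \<mu>) \<Omega>)"
  using assms sets_borel_le_caratheodory[OF assms(1)]
  by (subst nn_integral_restrict_space) auto

lemma emeasure_restrict_caratheodory:
  assumes \<nu>: "borel_regular_outer_measure \<nu>" and "open \<Omega>" "A \<in> sets borel" "A \<subseteq> \<Omega>"
  shows "emeasure (restrict_space (caratheodory_measure \<nu>) \<Omega>) A = \<nu> A"
  using assms sets_borel_le_caratheodory[OF \<nu>]
  by (subst emeasure_restrict_space) (auto simp: emeasure_caratheodory_borel[OF \<nu>])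

lemma borel_sublevel:
  fixes u :: "'a::metric_space \<Rightarrow> real"
  assumes "open \<Omega>" "continuous_on \<Omega> u" "B \<in> sets borel"
  shows "{x \<in> \<Omega>. u x \<in> B} \<in> sets borel"
proof -
  have "u -` B \<inter> space (restrict_space borel \<Omega>) \<in> sets (restrict_space borel \<Omega>)"
    using borel_measurable_continuous_on_restrict[OF assms(2)] assms(3) by (rule measurable_sets)
  then show ?thesis
    using assms(1) by (simp add: sets_restrict_space_iff space_restrict_space vimage_def Int_def conj_ac)
qed

lemma conductor_superlevel:
  fixes u :: "'a::metric_space \<Rightarrow> real"
  assumes "open \<Omega>" "continuous_on \<Omega> u" "l < h"
  shows "conductor \<Omega> {x \<in> \<Omega>. h \<le> u x} {x \<in> \<Omega>. l < u x}"
proof -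
  have "open {x \<in> \<Omega>. l < u x}"
    using continuous_open_preimage[OF assms(2,1) open_greaterThan[of l]]
    by (simp add: vimage_def Int_def conj_ac)
  moreover have "closedin (top_of_set \<Omega>) {x \<in> \<Omega>. h \<le> u x}"
    using continuous_closedin_preimage[OF assms(2) closed_atLeast[of h]]
    by (simp add: vimage_def Int_def conj_ac)
  ultimately show ?thesis using assms(3) by (auto simp: conductor_def)
qed

text \<open>The test function is the truncation of \<open>u\<close> to \<open>[l, h]\<close>, rescaled to run from \<open>0\<close> to \<open>1\<close>.\<close>

lemma conductivity_superlevel_le:
  fixes u :: "'a::metric_space \<Rightarrow> real"
  assumes \<mu>: "borel_regular_outer_measure \<mu>" and \<Omega>: "open \<Omega>" "\<mu> \<Omega> < \<infinity>" and p: "0 < p"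
    and u: "continuous_on \<Omega> u" and g: "weak_upper_gradient \<mu> \<Omega> p (\<lambda>x. ereal (u x)) g"
    and fin: "(\<integral>\<^sup>+ x\<in>\<Omega>. epowr (g x) p \<partial>caratheodory_measure \<mu>) < \<infinity>"
    and "l < h"
  shows "conductivity \<mu> p {x \<in> \<Omega>. h \<le> u x} {x \<in> \<Omega>. l < u x} \<Omega>
    \<le> ennreal ((1 / (h - l)) powr p) *
       (\<integral>\<^sup>+ x\<in>\<Omega>. epowr (g x) p * indicator {x. l \<le> u x \<and> u x \<le> h} x \<partial>caratheodory_measure \<mu>)"
proof -
  let ?M = "restrict_space (caratheodory_measure \<mu>) \<Omega>"
  define c where "c = 1 / (h - l)"
  have c: "0 < c" "c * (h - l) = 1" using \<open>l < h\<close> by (simp_all add: c_def)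
  define w where "w x = c * max l (min h (u x)) + - (c * l)" for x
  define g' where "g' x = (if l \<le> u x \<and> u x \<le> h then ennreal c * g x else 0)" for x
  have [measurable]: "g \<in> borel_measurable ?M"
    using g by (simp add: weak_upper_gradient_def)
  have [measurable]: "u \<in> borel_measurable ?M"
    using \<mu> u by (rule borel_measurable_caratheodory_continuous)
  have wug: "weak_upper_gradient \<mu> \<Omega> p (\<lambda>x. ereal (w x)) g'"
    unfolding w_def g'_def using \<mu> u g c by (intro weak_upper_gradient_truncation) auto
  have int: "(\<integral>\<^sup>+ x\<in>\<Omega>. epowr (g' x) p \<partial>caratheodory_measure \<mu>) = ennreal (c powr p) *
       (\<integral>\<^sup>+ x\<in>\<Omega>. epowr (g x) p * indicator {x. l \<le> u x \<and> u x \<le> h} x \<partial>caratheodory_measure \<mu>)"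
    (is "_ = _ * ?I")
  proof -
    have "(\<integral>\<^sup>+ x\<in>\<Omega>. epowr (g' x) p \<partial>caratheodory_measure \<mu>)
      = (\<integral>\<^sup>+ x. ennreal (c powr p) * (epowr (g x) p * indicator {x \<in> space ?M. l \<le> u x \<and> u x \<le> h} x) \<partial>?M)"
      unfolding set_nn_integral_restrict_space[OF \<mu> \<Omega>(1)]
      by (intro nn_integral_cong)
         (use c in \<open>auto simp: g'_def epowr_mult epowr_ennreal indicator_def\<close>)
    also have "\<dots> = ennreal (c powr p) *
        (\<integral>\<^sup>+ x. epowr (g x) p * indicator {x \<in> space ?M. l \<le> u x \<and> u x \<le> h} x \<partial>?M)"
      by (rule nn_integral_cmult) measurable
    also have "(\<integral>\<^sup>+ x. epowr (g x) p * indicator {x \<in> space ?M. l \<le> u x \<and> u x \<le> h} x \<partial>?M) = ?I"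
      unfolding set_nn_integral_restrict_space[OF \<mu> \<Omega>(1)]
      by (intro nn_integral_cong) (auto simp: indicator_def)
    finally show ?thesis .
  qed
  have "?I \<le> (\<integral>\<^sup>+ x\<in>\<Omega>. epowr (g x) p \<partial>caratheodory_measure \<mu>)"
    by (intro nn_integral_mono) (auto simp: indicator_def)
  then have "?I < \<infinity>"
    using fin by (rule le_less_trans)
  then have fin': "(\<integral>\<^sup>+ x\<in>\<Omega>. epowr (g' x) p \<partial>caratheodory_measure \<mu>) < \<infinity>"
    unfolding int by (simp add: ennreal_mult_less_top)
  have bounds: "0 \<le> w x" "w x \<le> 1" for x
  proof -
    have "w x = c * (max l (min h (u x)) - l)" by (simp add: w_def right_diff_distrib)
    moreover have "0 \<le> max l (min h (u x)) - l" "max l (min h (u x)) - l \<le> h - l"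
      using \<open>l < h\<close> by auto
    ultimately show "0 \<le> w x" "w x \<le> 1"
      using c mult_left_mono[of _ "h - l" c] by auto
  qed
  have "w \<in> newtonian_continuous \<mu> \<Omega> p"
  proof (rule bounded_newtonian_continuousI[OF \<mu> _ \<Omega>(2) _ _ p wug fin', where K = 1])
    show "continuous_on \<Omega> w" unfolding w_def by (intro continuous_intros u)
    show "\<bar>w x\<bar> \<le> 1" for x using bounds[of x] by auto
  qed (use \<Omega> in auto)
  moreover have "1 \<le> w x" if "h \<le> u x" for x
    using that c \<open>l < h\<close> by (simp add: w_def right_diff_distrib)
  moreover have "w x \<le> 0" if "\<not> l < u x" for x
    using that \<open>l < h\<close> by (simp add: w_def max_absorb1)
  ultimately have "w \<in> conductor_admissible \<mu> p {x \<in> \<Omega>. h \<le> u x} {x \<in> \<Omega>. l < u x} \<Omega>"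
    by (auto simp: conductor_admissible_def)
  then show ?thesis
    unfolding c_def[symmetric] int[symmetric] conductivity_def
    by (rule INF_lower2, intro INF_lower2[of g']) (use wug in auto)
qed

text \<open>The levels are the powers \<open>4\<^sup>j\<close> with \<open>j \<in> \<int>\<close>, enumerated by the natural numbers so that
  countable sums can be used.\<close>

lemma ex_power_of_4_level:
  assumes "0 < v"
  obtains n where "4 powr real_of_int (int_decode n) \<le> v" "v < 4 * 4 powr real_of_int (int_decode n)"
proof
  let ?n = "int_encode \<lfloor>log 4 v\<rfloor>"
  have "4 powr real_of_int (int_decode ?n) \<le> 4 powr log 4 v"
    by (intro powr_mono) auto
  then show "4 powr real_of_int (int_decode ?n) \<le> v"
    using assms by (simp add: powr_log_cancel)
  have "4 powr log 4 v < 4 powr (real_of_int (int_decode ?n) + 1)"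
    using real_of_int_floor_add_one_gt[of "log 4 v"] by (intro powr_less_mono) auto
  then show "v < 4 * 4 powr real_of_int (int_decode ?n)"
    using assms by (simp add: powr_log_cancel powr_add mult.commute)
qed

text \<open>The test function for the level \<open>4\<^sup>j\<close> varies in the closed band \<open>[4\<^sup>j / 2, 4\<^sup>j]\<close>.  The ratio \<open>4\<close>
  of consecutive levels, rather than \<open>2\<close>, keeps these closed bands disjoint.\<close>

lemma disjoint_power_of_4_bands:
  "disjoint_family (\<lambda>n. {x. 4 powr real_of_int (int_decode n) / 2 \<le> u x \<and> u x \<le> 4 powr real_of_int (int_decode n)})"
proof -
  have "i = j" if "4 powr real_of_int i / 2 \<le> v" "v \<le> 4 powr real_of_int i"
    "4 powr real_of_int j / 2 \<le> v" "v \<le> 4 powr real_of_int j" for i j :: int and v :: real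
  proof -
    have *: "j \<le> i" if "4 powr real_of_int j / 2 \<le> v" "v \<le> 4 powr real_of_int i" for i j
    proof (rule ccontr)
      assume "\<not> j \<le> i"
      then have "(4::real) powr (real_of_int i + 1) \<le> 4 powr real_of_int j"
        by (intro powr_mono) auto
      moreover have "0 < (4::real) powr real_of_int i" by simp
      ultimately show False using that by (simp add: powr_add)
    qed
    show ?thesis using *[of i j] *[of j i] that by simp
  qed
  then show ?thesis
    unfolding disjoint_family_on_def by (auto dest!: injD[OF inj_int_decode, rotated]) 
qed

text \<open>Maz'ya's truncation argument.  With \<open>l\<close> running through the powers of 4, the integral of
  \<open>max 0 u\<close> to the power \<open>q\<close> is at most the sum of \<open>(4 l)\<^sup>q \<nu> {u \<ge> l}\<close>.  The conductor inequality for the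
  pair \<open>{u \<ge> l} \<subseteq> {u > l / 2}\<close> bounds \<open>\<nu> {u \<ge> l}\<close> to the power \<open>p / q\<close> by \<open>\<gamma> (2 / l)\<^sup>p\<close> times the energy of
  \<open>u\<close> in the band \<open>{l / 2 \<le> u \<le> l}\<close>.  The powers of \<open>l\<close> cancel, leaving the factor \<open>8\<^sup>p\<close>, and the
  energies of the disjoint bands add up to at most the total energy.\<close>

lemma positive_part_estimate:
  fixes u :: "'a::metric_space \<Rightarrow> real"
  assumes \<mu>: "borel_regular_outer_measure \<mu>" and \<nu>: "borel_regular_outer_measure \<nu>"
    and \<Omega>: "open \<Omega>" "\<mu> \<Omega> < \<infinity>" and pq: "0 < p" "p \<le> q" and "0 \<le> \<gamma>"
    and ineq: "\<And>F G. conductor \<Omega> F G \<Longrightarrow> \<nu> G \<le> \<nu> \<Omega> / 2 \<Longrightarrow>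
            epowr (\<nu> F) (p / q) \<le> ennreal \<gamma> * conductivity \<mu> p F G \<Omega>"
    and u: "continuous_on \<Omega> u" and g: "weak_upper_gradient \<mu> \<Omega> p (\<lambda>x. ereal (u x)) g"
    and fin: "(\<integral>\<^sup>+ x\<in>\<Omega>. epowr (g x) p \<partial>caratheodory_measure \<mu>) < \<infinity>"
    and half: "\<nu> {x \<in> \<Omega>. 0 < u x} \<le> \<nu> \<Omega> / 2"
  shows "(\<integral>\<^sup>+ x\<in>\<Omega>. ennreal (max 0 (u x) powr q) \<partial>caratheodory_measure \<nu>)
    \<le> epowr (ennreal (\<gamma> * 8 powr p) * (\<integral>\<^sup>+ x\<in>\<Omega>. epowr (g x) p \<partial>caratheodory_measure \<mu>)) (q / p)"
proof -
  let ?M = "restrict_space (caratheodory_measure \<mu>) \<Omega>" and ?N = "restrict_space (caratheodory_measure \<nu>) \<Omega>"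
  have [measurable]: "g \<in> borel_measurable ?M"
    using g by (simp add: weak_upper_gradient_def)
  have [measurable]: "u \<in> borel_measurable ?M" "u \<in> borel_measurable ?N"
    using \<mu> \<nu> u by (auto intro: borel_measurable_caratheodory_continuous)
  define l where "l n = 4 powr real_of_int (int_decode n)" for n
  have l: "0 < l n" for n by (simp add: l_def)
  define F where "F n = {x \<in> \<Omega>. l n \<le> u x}" for n
  define A where "A n = {x. l n / 2 \<le> u x \<and> u x \<le> l n}" for n
  define E where "E n = (\<integral>\<^sup>+ x\<in>\<Omega>. epowr (g x) p * indicator (A n) x \<partial>caratheodory_measure \<mu>)" for n
  have F_borel: "F n \<in> sets borel" for n
    using borel_sublevel[OF \<Omega>(1) u, of "{l n..}"] by (simp add: F_def)
  have F_sets [measurable]: "F n \<in> sets ?N" for n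
  proof -
    have "\<Omega> \<in> sets (caratheodory_measure \<nu>)" "F n \<in> sets (caratheodory_measure \<nu>)"
      using F_borel[of n] \<Omega>(1) sets_borel_le_caratheodory[OF \<nu>] by auto
    then show ?thesis by (subst sets_restrict_space_iff) (auto simp: F_def)
  qed

  have level: "\<nu> (F n) \<le> epowr (ennreal \<gamma> * (ennreal ((2 / l n) powr p) * E n)) (q / p)" for n
  proof -
    let ?G = "{x \<in> \<Omega>. l n / 2 < u x}"
    have "\<nu> ?G \<le> \<nu> {x \<in> \<Omega>. 0 < u x}"
    proof -
      have sets: "?G \<in> sets borel" "{x \<in> \<Omega>. 0 < u x} \<in> sets borel"
        using borel_sublevel[OF \<Omega>(1) u, of "{l n / 2<..}"] borel_sublevel[OF \<Omega>(1) u, of "{0<..}"]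
        by simp_all
      have "emeasure (caratheodory_measure \<nu>) ?G \<le> emeasure (caratheodory_measure \<nu>) {x \<in> \<Omega>. 0 < u x}"
        using sets sets_borel_le_caratheodory[OF \<nu>] l[of n] by (intro emeasure_mono) auto
      then show ?thesis using sets by (simp add: emeasure_caratheodory_borel[OF \<nu>])
    qed
    then have "\<nu> ?G \<le> \<nu> \<Omega> / 2" using half by (rule order_trans)
    then have "epowr (\<nu> (F n)) (p / q) \<le> ennreal \<gamma> * conductivity \<mu> p (F n) ?G \<Omega>"
      using l[of n] unfolding F_def by (intro ineq conductor_superlevel \<Omega> u) auto
    also have "\<dots> \<le> ennreal \<gamma> * (ennreal ((2 / l n) powr p) * E n)"
      using conductivity_superlevel_le[OF \<mu> \<Omega> pq(1) u g fin, of "l n / 2" "l n"] l[of n]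
      unfolding F_def E_def A_def by (intro mult_left_mono) (simp_all add: field_simps)
    finally have "epowr (epowr (\<nu> (F n)) (p / q)) (q / p)
        \<le> epowr (ennreal \<gamma> * (ennreal ((2 / l n) powr p) * E n)) (q / p)"
      using pq by (intro epowr_mono) auto
    then show ?thesis using pq by (simp add: epowr_epowr)
  qed

  have "(\<integral>\<^sup>+ x\<in>\<Omega>. ennreal (max 0 (u x) powr q) \<partial>caratheodory_measure \<nu>)
      \<le> (\<integral>\<^sup>+ x. (\<Sum>n. ennreal ((4 * l n) powr q) * indicator (F n) x) \<partial>?N)"
    unfolding set_nn_integral_restrict_space[OF \<nu> \<Omega>(1)]
  proof (rule nn_integral_mono)
    fix x assume "x \<in> space ?N"
    then have x: "x \<in> \<Omega>" by (simp add: space_restrict_space)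
    show "ennreal (max 0 (u x) powr q) \<le> (\<Sum>n. ennreal ((4 * l n) powr q) * indicator (F n) x)"
    proof (cases "0 < u x")
      case True
      then obtain k where k: "l k \<le> u x" "u x < 4 * l k"
        using ex_power_of_4_level unfolding l_def by blast
      have "ennreal (max 0 (u x) powr q) \<le> ennreal ((4 * l k) powr q) * indicator (F k) x"
        using True k x pq by (auto simp: F_def intro!: ennreal_leI powr_mono2)
      also have "\<dots> = (\<Sum>n\<in>{k}. ennreal ((4 * l n) powr q) * indicator (F n) x)"
        by (simp only: sum.insert finite.emptyI empty_iff not_False_eq_True sum.empty add_0_right)
      also have "\<dots> \<le> (\<Sum>n. ennreal ((4 * l n) powr q) * indicator (F n) x)"
        by (rule sum_le_suminf) auto
      finally show ?thesis .
    qed (use pq in simp)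
  qed
  also have "\<dots> = (\<Sum>n. ennreal ((4 * l n) powr q) * \<nu> (F n))"
    by (simp add: nn_integral_suminf nn_integral_cmult_indicator
          emeasure_restrict_caratheodory[OF \<nu> \<Omega>(1) F_borel] F_def[THEN equalityD1, THEN subset_trans])
  also have "\<dots> \<le> (\<Sum>n. epowr (ennreal (\<gamma> * 8 powr p) * E n) (q / p))"
  proof (intro suminf_le summableI)
    fix n
    have powers: "(4 * l n) powr q = ((4 * l n) powr p) powr (q / p)"
        "(4 * l n) powr p * (2 / l n) powr p = 8 powr p"
      using pq l[of n] by (simp_all add: powr_powr powr_mult[symmetric])
    have "ennreal ((4 * l n) powr q) * \<nu> (F n)
        \<le> epowr (ennreal ((4 * l n) powr p)) (q / p) * epowr (ennreal \<gamma> * (ennreal ((2 / l n) powr p) * E n)) (q / p)"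
      using level[of n] by (simp add: powers(1) epowr_ennreal mult_left_mono)
    also have "\<dots> = epowr (ennreal (\<gamma> * ((4 * l n) powr p * (2 / l n) powr p)) * E n) (q / p)"
      using \<open>0 \<le> \<gamma>\<close> by (simp add: epowr_mult[symmetric] ennreal_mult mult_ac)
    finally show "ennreal ((4 * l n) powr q) * \<nu> (F n) \<le> epowr (ennreal (\<gamma> * 8 powr p) * E n) (q / p)"
      unfolding powers(2) .
  qed
  also have "\<dots> \<le> epowr (\<Sum>n. ennreal (\<gamma> * 8 powr p) * E n) (q / p)"
    using pq by (intro suminf_epowr_le) simp
  also have "\<dots> \<le> epowr (ennreal (\<gamma> * 8 powr p) * (\<integral>\<^sup>+ x\<in>\<Omega>. epowr (g x) p \<partial>caratheodory_measure \<mu>)) (q / p)"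
  proof (intro epowr_mono)
    let ?B = "\<lambda>n. {x \<in> space ?M. l n / 2 \<le> u x \<and> u x \<le> l n}"
    have disj: "disjoint_family ?B"
      using disjoint_power_of_4_bands[of u] unfolding l_def disjoint_family_on_def by blast
    have "(\<Sum>n. E n) = (\<Sum>n. \<integral>\<^sup>+ x. epowr (g x) p * indicator (?B n) x \<partial>?M)"
      unfolding E_def set_nn_integral_restrict_space[OF \<mu> \<Omega>(1)]
      by (intro suminf_cong nn_integral_cong) (auto simp: indicator_def A_def)
    also have "\<dots> = (\<integral>\<^sup>+ x. (\<Sum>n. epowr (g x) p * indicator (?B n) x) \<partial>?M)"
      by (rule nn_integral_suminf[symmetric]) measurable
    also have "\<dots> = (\<integral>\<^sup>+ x. epowr (g x) p * indicator (\<Union>n. ?B n) x \<partial>?M)"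
      by (simp only: ennreal_suminf_cmult suminf_indicator[OF disj])
    also have "\<dots> \<le> (\<integral>\<^sup>+ x\<in>\<Omega>. epowr (g x) p \<partial>caratheodory_measure \<mu>)"
      unfolding set_nn_integral_restrict_space[OF \<mu> \<Omega>(1)]
      by (intro nn_integral_mono) (auto simp: indicator_def)
    finally show "(\<Sum>n. ennreal (\<gamma> * 8 powr p) * E n)
        \<le> ennreal (\<gamma> * 8 powr p) * (\<integral>\<^sup>+ x\<in>\<Omega>. epowr (g x) p \<partial>caratheodory_measure \<mu>)"
      by (simp add: mult_left_mono)
  qed (use pq in simp)
  finally show ?thesis .
qed

lemma obtain_median_in_open:
  fixes u :: "'a::metric_space \<Rightarrow> real"
  assumes \<nu>: "borel_regular_outer_measure \<nu>" and \<Omega>: "open \<Omega>" "\<nu> \<Omega> < \<infinity>" and u: "continuous_on \<Omega> u"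
  obtains m where "\<nu> {x \<in> \<Omega>. m < u x} \<le> \<nu> \<Omega> / 2" "\<nu> {x \<in> \<Omega>. u x < m} \<le> \<nu> \<Omega> / 2"
proof -
  let ?N = "restrict_space (caratheodory_measure \<nu>) \<Omega>"
  have space: "space ?N = \<Omega>" by (simp add: space_restrict_space)
  have em: "emeasure ?N A = \<nu> A" if "A \<in> sets borel" "A \<subseteq> \<Omega>" for A
    using emeasure_restrict_caratheodory[OF \<nu> \<Omega>(1) that] .
  interpret finite_measure ?N
    by (rule finite_measureI) (use em[of \<Omega>] \<Omega> in \<open>simp add: space\<close>)
  have "u \<in> borel_measurable ?N"
    using \<nu> u by (rule borel_measurable_caratheodory_continuous)
  then obtain m where m: "measure ?N {x \<in> \<Omega>. m < u x} \<le> measure ?N \<Omega> / 2"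
      "measure ?N {x \<in> \<Omega>. u x < m} \<le> measure ?N \<Omega> / 2"
    using obtain_median unfolding space by blast
  have *: "\<nu> A \<le> \<nu> \<Omega> / 2" if "A \<in> sets borel" "A \<subseteq> \<Omega>" "measure ?N A \<le> measure ?N \<Omega> / 2" for A
  proof -
    have "\<nu> A \<le> ennreal (measure ?N \<Omega> / 2)"
      using that em[of A] by (simp add: emeasure_eq_measure[symmetric] flip: em) (simp add: emeasure_eq_measure ennreal_leI)
    also have "\<dots> = ennreal (measure ?N \<Omega>) / ennreal 2"
      by (rule divide_ennreal[symmetric]) auto
    also have "\<dots> = \<nu> \<Omega> / 2"
      using em[of \<Omega>] \<Omega> by (simp add: emeasure_eq_measure)
    finally show ?thesis .
  qed
  show ?thesis
    using borel_sublevel[OF \<Omega>(1) u, of "{m<..}"] borel_sublevel[OF \<Omega>(1) u, of "{..<m}"] m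
    by (intro that[of m] *) auto
qed

text \<open>For a median \<open>m\<close>, the previous estimate applies both to \<open>u - m\<close> and to \<open>m - u\<close>, whose positive
  parts make up \<open>\<bar>u - m\<bar>\<close>.  The factor \<open>2\<close> in the constant comes from adding the two estimates.\<close>

lemma Poincare_inequality_of_conductor_inequality:
  fixes u :: "'a::metric_space \<Rightarrow> real"
  assumes \<mu>: "borel_regular_outer_measure \<mu>" and \<nu>: "borel_regular_outer_measure \<nu>"
    and \<Omega>: "open \<Omega>" "\<mu> \<Omega> < \<infinity>" and pq: "0 < p" "p \<le> q" and "0 < \<gamma>"
    and ineq: "\<And>F G. conductor \<Omega> F G \<Longrightarrow> \<nu> G \<le> \<nu> \<Omega> / 2 \<Longrightarrow>
            epowr (\<nu> F) (p / q) \<le> ennreal \<gamma> * conductivity \<mu> p F G \<Omega>"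
    and u: "continuous_on \<Omega> u" and g: "weak_upper_gradient \<mu> \<Omega> p (\<lambda>x. ereal (u x)) g"
  shows "(INF a::real. epowr (\<integral>\<^sup>+ x\<in>\<Omega>. ennreal (\<bar>u x - a\<bar> powr q) \<partial>caratheodory_measure \<nu>) (1 / q))
     \<le> ennreal ((2 * \<gamma> * 8 powr p) powr (1 / p)) *
        epowr (\<integral>\<^sup>+ x\<in>\<Omega>. epowr (g x) p \<partial>caratheodory_measure \<mu>) (1 / p)"
proof (cases "(\<integral>\<^sup>+ x\<in>\<Omega>. epowr (g x) p \<partial>caratheodory_measure \<mu>) < \<infinity>")
  case False
  then show ?thesis
    using \<open>0 < \<gamma>\<close> by (simp add: less_top[symmetric] ennreal_mult_top)
next
  case fin: True
  let ?E = "\<integral>\<^sup>+ x\<in>\<Omega>. epowr (g x) p \<partial>caratheodory_measure \<mu>"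
  have "\<nu> \<Omega> < \<infinity>"
    using \<mu> \<Omega> pq(1) ineq by (rule finite_of_conductor_inequality)
  then obtain m where m: "\<nu> {x \<in> \<Omega>. m < u x} \<le> \<nu> \<Omega> / 2" "\<nu> {x \<in> \<Omega>. u x < m} \<le> \<nu> \<Omega> / 2"
    using obtain_median_in_open[OF \<nu> \<Omega>(1) _ u] by blast
  let ?X = "epowr (ennreal (\<gamma> * 8 powr p) * ?E) (q / p)"
  have above: "(\<integral>\<^sup>+ x\<in>\<Omega>. ennreal (max 0 (u x - m) powr q) \<partial>caratheodory_measure \<nu>) \<le> ?X"
    using m \<open>0 < \<gamma>\<close>
    by (intro positive_part_estimate[OF \<mu> \<nu> \<Omega> pq _ ineq] fin continuous_intros u
          weak_upper_gradient_same_oscillation[OF g]) auto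
  have below: "(\<integral>\<^sup>+ x\<in>\<Omega>. ennreal (max 0 (m - u x) powr q) \<partial>caratheodory_measure \<nu>) \<le> ?X"
    using m \<open>0 < \<gamma>\<close>
    by (intro positive_part_estimate[OF \<mu> \<nu> \<Omega> pq _ ineq] fin continuous_intros u
          weak_upper_gradient_same_oscillation[OF g]) auto
  let ?N = "restrict_space (caratheodory_measure \<nu>) \<Omega>"
  have [measurable]: "u \<in> borel_measurable ?N"
    using \<nu> u by (rule borel_measurable_caratheodory_continuous)
  have "(\<integral>\<^sup>+ x\<in>\<Omega>. ennreal (\<bar>u x - m\<bar> powr q) \<partial>caratheodory_measure \<nu>)
      = (\<integral>\<^sup>+ x. ennreal (max 0 (u x - m) powr q) + ennreal (max 0 (m - u x) powr q) \<partial>?N)"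
    unfolding set_nn_integral_restrict_space[OF \<nu> \<Omega>(1)] using pq
    by (intro nn_integral_cong) (auto simp: max_def abs_if)
  also have "\<dots> = (\<integral>\<^sup>+ x\<in>\<Omega>. ennreal (max 0 (u x - m) powr q) \<partial>caratheodory_measure \<nu>)
      + (\<integral>\<^sup>+ x\<in>\<Omega>. ennreal (max 0 (m - u x) powr q) \<partial>caratheodory_measure \<nu>)"
    unfolding set_nn_integral_restrict_space[OF \<nu> \<Omega>(1)] by (rule nn_integral_add) measurable
  also have "\<dots> \<le> ?X + ?X" using above below by (rule add_mono)
  also have "\<dots> \<le> epowr (ennreal (\<gamma> * 8 powr p) * ?E + ennreal (\<gamma> * 8 powr p) * ?E) (q / p)"
    using pq by (intro epowr_superadd) simp
  also have "ennreal (\<gamma> * 8 powr p) * ?E + ennreal (\<gamma> * 8 powr p) * ?E = ennreal (2 * \<gamma> * 8 powr p) * ?E"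
    using \<open>0 < \<gamma>\<close> by (simp add: distrib_right[symmetric] ennreal_plus[symmetric] del: ennreal_plus)
  finally have "epowr (\<integral>\<^sup>+ x\<in>\<Omega>. ennreal (\<bar>u x - m\<bar> powr q) \<partial>caratheodory_measure \<nu>) (1 / q)
      \<le> epowr (epowr (ennreal (2 * \<gamma> * 8 powr p) * ?E) (q / p)) (1 / q)"
    using pq by (intro epowr_mono) auto
  also have "\<dots> = ennreal ((2 * \<gamma> * 8 powr p) powr (1 / p)) * epowr ?E (1 / p)"
    using pq \<open>0 < \<gamma>\<close> by (simp add: epowr_epowr epowr_mult epowr_ennreal powr_powr)
  finally show ?thesis by (rule INF_lower2[rotated]) simp
qed

section \<open>From the Poincare inequality to the conductor inequality\<close>

text \<open>No constant \<open>a\<close> is close to \<open>u\<close> both on \<open>F\<close>, where \<open>u \<ge> 1\<close>, and on \<open>\<Omega> - G\<close>, where \<open>u \<le> 0\<close>: on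
  one of these sets \<open>\<bar>u - a\<bar> \<ge> 1 / 2\<close>.  Both have at least the measure of \<open>F\<close>, because \<open>G\<close> takes up
  at most half of \<open>\<Omega>\<close>.  Finiteness of \<open>\<nu> G\<close> permits the subtraction that gives
  \<open>\<nu> G \<le> \<nu> (\<Omega> - G)\<close>, also when \<open>\<nu> \<Omega> = \<infinity>\<close>.\<close>

lemma conductor_half_oscillation:
  fixes u :: "'a::metric_space \<Rightarrow> real"
  assumes \<nu>: "borel_regular_outer_measure \<nu>" and "open \<Omega>" and q: "0 < q"
    and FG: "conductor \<Omega> F G" "\<nu> G \<le> \<nu> \<Omega> / 2" "\<nu> G < \<infinity>"
    and u: "\<And>x. x \<in> F \<Longrightarrow> 1 \<le> u x" "\<And>x. x \<in> \<Omega> - G \<Longrightarrow> u x \<le> 0"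
  shows "ennreal ((1 / 2) powr q) * \<nu> F \<le> (\<integral>\<^sup>+ x\<in>\<Omega>. ennreal (\<bar>u x - a\<bar> powr q) \<partial>caratheodory_measure \<nu>)"
proof -
  let ?N = "caratheodory_measure \<nu>"
  have borel: "F \<in> sets borel" "G \<in> sets borel" "\<Omega> \<in> sets borel"
  proof -
    obtain T where "closed T" "F = \<Omega> \<inter> T"
      using FG(1) by (auto simp: conductor_def closedin_closed)
    then show "F \<in> sets borel" using \<open>open \<Omega>\<close> by auto
  qed (use FG(1) \<open>open \<Omega>\<close> in \<open>auto simp: conductor_def\<close>)
  have sub: "F \<subseteq> G" "G \<subseteq> \<Omega>" using FG(1) by (auto simp: conductor_def)
  have sets: "A \<in> sets ?N" if "A \<in> sets borel" for A
    using that sets_borel_le_caratheodory[OF \<nu>] by auto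
  have em: "emeasure ?N A = \<nu> A" if "A \<in> sets borel" for A
    using emeasure_caratheodory_borel[OF \<nu> that] .
  have on: "ennreal ((1 / 2) powr q) * \<nu> A \<le> (\<integral>\<^sup>+ x\<in>\<Omega>. ennreal (\<bar>u x - a\<bar> powr q) \<partial>?N)"
    if A: "A \<in> sets borel" "A \<subseteq> \<Omega>" and far: "\<And>x. x \<in> A \<Longrightarrow> 1 / 2 \<le> \<bar>u x - a\<bar>" for A
  proof -
    have "ennreal ((1 / 2) powr q) * \<nu> A = (\<integral>\<^sup>+ x. ennreal ((1 / 2) powr q) * indicator A x \<partial>?N)"
      using sets[OF A(1)] by (simp add: nn_integral_cmult_indicator em[OF A(1)])
    also have "\<dots> \<le> (\<integral>\<^sup>+ x\<in>\<Omega>. ennreal (\<bar>u x - a\<bar> powr q) \<partial>?N)"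
      using A(2) far q
      by (intro nn_integral_mono) (auto simp: indicator_def intro!: ennreal_leI powr_mono2)
    finally show ?thesis .
  qed
  show ?thesis
  proof (cases "a \<le> 1 / 2")
    case True
    then show ?thesis using on[OF borel(1)] sub u(1) by force
  next
    case False
    have "\<nu> F \<le> \<nu> G"
      using emeasure_mono[OF sub(1) sets[OF borel(2)]] borel by (simp add: em)
    also have "\<nu> G \<le> \<nu> (\<Omega> - G)"
    proof -
      have "\<nu> \<Omega> = \<nu> G + \<nu> (\<Omega> - G)"
        using plus_emeasure[of G ?N "\<Omega> - G"] sets borel sub by (simp add: em Un_absorb1)
      moreover have "\<nu> G + \<nu> G \<le> \<nu> \<Omega>"
      proof -
        have "2 * \<nu> G \<le> 2 * (\<nu> \<Omega> / 2)" using FG(2) by (rule mult_left_mono) simp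
        also have "\<dots> = \<nu> \<Omega>"
          by (simp add: ennreal_times_divide mult_divide_eq_ennreal mult.commute[of 2])
        finally show ?thesis by (simp add: mult_2)
      qed
      ultimately have "\<nu> G + \<nu> G \<le> \<nu> G + \<nu> (\<Omega> - G)" by simp
      then show ?thesis using FG(3) by (auto simp: ennreal_add_left_cancel_le)
    qed
    finally have "ennreal ((1 / 2) powr q) * \<nu> F \<le> ennreal ((1 / 2) powr q) * \<nu> (\<Omega> - G)"
      by (rule mult_left_mono) simp
    also have "\<dots> \<le> (\<integral>\<^sup>+ x\<in>\<Omega>. ennreal (\<bar>u x - a\<bar> powr q) \<partial>?N)"
      using borel False u(2) by (intro on) force+
    finally show ?thesis .
  qed
qed

lemma conductor_inequality_of_Poincare_inequality:
  fixes \<mu> \<nu> :: "'a::metric_space set \<Rightarrow> ennreal"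
  assumes \<nu>: "borel_regular_outer_measure \<nu>" and \<Omega>: "open \<Omega>" and pq: "0 < p" "p \<le> q" and "0 < c"
    and ineq: "\<And>u g. u \<in> newtonian_continuous \<mu> \<Omega> p \<Longrightarrow> weak_upper_gradient \<mu> \<Omega> p (\<lambda>x. ereal (u x)) g \<Longrightarrow>
            (INF a::real. epowr (\<integral>\<^sup>+ x\<in>\<Omega>. ennreal (\<bar>u x - a\<bar> powr q) \<partial>caratheodory_measure \<nu>) (1 / q))
            \<le> ennreal c * epowr (\<integral>\<^sup>+ x\<in>\<Omega>. epowr (g x) p \<partial>caratheodory_measure \<mu>) (1 / p)"
    and FG: "conductor \<Omega> F G" "\<nu> G \<le> \<nu> \<Omega> / 2" "\<nu> G < \<infinity>"
  shows "epowr (\<nu> F) (p / q) \<le> ennreal ((2 * c) powr p) * conductivity \<mu> p F G \<Omega>"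
proof -
  have admissible: "epowr (\<nu> F) (p / q) \<le> ennreal ((2 * c) powr p) * (\<integral>\<^sup>+ x\<in>\<Omega>. epowr (g x) p \<partial>caratheodory_measure \<mu>)"
    if u: "u \<in> conductor_admissible \<mu> p F G \<Omega>" and g: "weak_upper_gradient \<mu> \<Omega> p (\<lambda>x. ereal (u x)) g" for u g
  proof -
    let ?E = "\<integral>\<^sup>+ x\<in>\<Omega>. epowr (g x) p \<partial>caratheodory_measure \<mu>"
    have "ennreal (1 / 2) * epowr (\<nu> F) (1 / q)
        \<le> (INF a::real. epowr (\<integral>\<^sup>+ x\<in>\<Omega>. ennreal (\<bar>u x - a\<bar> powr q) \<partial>caratheodory_measure \<nu>) (1 / q))"
    proof (rule INF_greatest)
      fix a :: real
      have "epowr (ennreal ((1 / 2) powr q) * \<nu> F) (1 / q)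
          \<le> epowr (\<integral>\<^sup>+ x\<in>\<Omega>. ennreal (\<bar>u x - a\<bar> powr q) \<partial>caratheodory_measure \<nu>) (1 / q)"
        using u pq by (intro epowr_mono conductor_half_oscillation[OF \<nu> \<Omega> _ FG])
          (auto simp: conductor_admissible_def)
      then show "ennreal (1 / 2) * epowr (\<nu> F) (1 / q)
          \<le> epowr (\<integral>\<^sup>+ x\<in>\<Omega>. ennreal (\<bar>u x - a\<bar> powr q) \<partial>caratheodory_measure \<nu>) (1 / q)"
        using pq by (simp add: epowr_mult epowr_ennreal powr_powr)
    qed
    also have "\<dots> \<le> ennreal c * epowr ?E (1 / p)"
      using u g by (intro ineq) (auto simp: conductor_admissible_def)
    finally have "ennreal 2 * (ennreal (1 / 2) * epowr (\<nu> F) (1 / q)) \<le> ennreal 2 * (ennreal c * epowr ?E (1 / p))"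
      by (rule mult_left_mono) simp
    moreover have "ennreal 2 * ennreal (1 / 2) = 1"
      using ennreal_mult[of 2 "1 / 2"] by simp
    moreover have "ennreal 2 * ennreal c = ennreal (2 * c)"
      using \<open>0 < c\<close> ennreal_mult[of 2 c] by simp
    ultimately have "epowr (\<nu> F) (1 / q) \<le> ennreal (2 * c) * epowr ?E (1 / p)"
      by (simp add: mult.assoc[symmetric] del: ennreal_numeral)
    then have "epowr (epowr (\<nu> F) (1 / q)) p \<le> epowr (ennreal (2 * c) * epowr ?E (1 / p)) p"
      using pq by (intro epowr_mono) auto
    then show ?thesis
      using pq \<open>0 < c\<close> by (simp add: epowr_mult epowr_epowr epowr_ennreal)
  qed
  have C: "0 < (2 * c) powr p" using \<open>0 < c\<close> by simp
  have "ennreal (1 / (2 * c) powr p) * epowr (\<nu> F) (p / q) \<le> conductivity \<mu> p F G \<Omega>"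
    unfolding conductivity_def
  proof (intro INF_greatest)
    fix u g assume "u \<in> conductor_admissible \<mu> p F G \<Omega>"
      "g \<in> {g. weak_upper_gradient \<mu> \<Omega> p (\<lambda>x. ereal (u x)) g}"
    then have "ennreal (1 / (2 * c) powr p) * epowr (\<nu> F) (p / q)
        \<le> ennreal (1 / (2 * c) powr p) * (ennreal ((2 * c) powr p) * (\<integral>\<^sup>+ x\<in>\<Omega>. epowr (g x) p \<partial>caratheodory_measure \<mu>))"
      by (intro mult_left_mono admissible) auto
    also have "\<dots> = (\<integral>\<^sup>+ x\<in>\<Omega>. epowr (g x) p \<partial>caratheodory_measure \<mu>)"
      using C ennreal_mult[of "1 / (2 * c) powr p" "(2 * c) powr p"] by (simp add: mult.assoc[symmetric])
    finally show "ennreal (1 / (2 * c) powr p) * epowr (\<nu> F) (p / q)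
        \<le> (\<integral>\<^sup>+ x\<in>\<Omega>. epowr (g x) p \<partial>caratheodory_measure \<mu>)" .
  qed
  then have "ennreal ((2 * c) powr p) * (ennreal (1 / (2 * c) powr p) * epowr (\<nu> F) (p / q))
      \<le> ennreal ((2 * c) powr p) * conductivity \<mu> p F G \<Omega>"
    by (rule mult_left_mono) simp
  then show ?thesis
    using C ennreal_mult[of "(2 * c) powr p" "1 / (2 * c) powr p"] by (simp add: mult.assoc[symmetric])
qed

section \<open>The equivalence of the two inequalities\<close>

theorem theorem4p3:
  fixes \<mu> \<nu> :: "'a::metric_space set \<Rightarrow> ennreal"
    and \<Omega> :: "'a set"
    and p q :: real
  assumes "borel_regular_outer_measure \<mu>"
    and "\<And>x r. 0 < r \<Longrightarrow> 0 < \<mu> (ball x r) \<and> \<mu> (ball x r) < \<infinity>"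
    and "bounded \<Omega>" and "open \<Omega>"
    and "borel_regular_outer_measure \<nu>"
    and "1 \<le> p" and "p \<le> q"
  shows
    "((\<exists>\<gamma>::real. 0 < \<gamma> \<and>
         (\<forall>F G. conductor \<Omega> F G \<and> \<nu> G \<le> \<nu> \<Omega> / 2 \<longrightarrow>
            epowr (\<nu> F) (p / q) \<le> ennreal \<gamma> * conductivity \<mu> p F G \<Omega>))
      \<longrightarrow>
      (\<exists>c::real. 0 < c \<and>
         (\<forall>u \<in> newtonian_continuous \<mu> \<Omega> p. \<forall>g.
            weak_upper_gradient \<mu> \<Omega> p (\<lambda>x. ereal (u x)) g \<longrightarrow>
            (INF a::real. epowr
               (\<integral>\<^sup>+ x\<in>\<Omega>. ennreal (\<bar>u x - a\<bar> powr q) \<partial>caratheodory_measure \<nu>) (1 / q))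
            \<le> ennreal c *
               epowr (\<integral>\<^sup>+ x\<in>\<Omega>. epowr (g x) p \<partial>caratheodory_measure \<mu>) (1 / p))))
     \<and>
     ((\<exists>c::real. 0 < c \<and>
         (\<forall>u \<in> newtonian_continuous \<mu> \<Omega> p. \<forall>g.
            weak_upper_gradient \<mu> \<Omega> p (\<lambda>x. ereal (u x)) g \<longrightarrow>
            (INF a::real. epowr
               (\<integral>\<^sup>+ x\<in>\<Omega>. ennreal (\<bar>u x - a\<bar> powr q) \<partial>caratheodory_measure \<nu>) (1 / q))
            \<le> ennreal c *
               epowr (\<integral>\<^sup>+ x\<in>\<Omega>. epowr (g x) p \<partial>caratheodory_measure \<mu>) (1 / p)))
      \<longrightarrow>
      (\<exists>\<gamma>::real. 0 < \<gamma> \<and>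
         (\<forall>F G. conductor \<Omega> F G \<and> \<nu> G \<le> \<nu> \<Omega> / 2 \<and> \<nu> G < \<infinity> \<longrightarrow>
            epowr (\<nu> F) (p / q) \<le> ennreal \<gamma> * conductivity \<mu> p F G \<Omega>)))"
proof -
  have pq: "0 < p" "p \<le> q" using assms(6,7) by auto
  have finite: "\<mu> \<Omega> < \<infinity>"
    using assms(2) by (intro bounded_finite_outer_measure[OF assms(1) _ assms(3,4)]) blast
  show ?thesis
  proof (intro conjI impI; elim exE conjE)
    fix \<gamma> :: real
    assume "0 < \<gamma>" and ineq: "\<forall>F G. conductor \<Omega> F G \<and> \<nu> G \<le> \<nu> \<Omega> / 2 \<longrightarrow>
            epowr (\<nu> F) (p / q) \<le> ennreal \<gamma> * conductivity \<mu> p F G \<Omega>"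
    show "\<exists>c::real. 0 < c \<and>
         (\<forall>u \<in> newtonian_continuous \<mu> \<Omega> p. \<forall>g.
            weak_upper_gradient \<mu> \<Omega> p (\<lambda>x. ereal (u x)) g \<longrightarrow>
            (INF a::real. epowr
               (\<integral>\<^sup>+ x\<in>\<Omega>. ennreal (\<bar>u x - a\<bar> powr q) \<partial>caratheodory_measure \<nu>) (1 / q))
            \<le> ennreal c *
               epowr (\<integral>\<^sup>+ x\<in>\<Omega>. epowr (g x) p \<partial>caratheodory_measure \<mu>) (1 / p))"
    proof (intro exI conjI ballI allI impI)
      show "0 < (2 * \<gamma> * 8 powr p) powr (1 / p)" using \<open>0 < \<gamma>\<close> by simp
    next
      fix u g assume "u \<in> newtonian_continuous \<mu> \<Omega> p" "weak_upper_gradient \<mu> \<Omega> p (\<lambda>x. ereal (u x)) g"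
      then show "(INF a::real. epowr
               (\<integral>\<^sup>+ x\<in>\<Omega>. ennreal (\<bar>u x - a\<bar> powr q) \<partial>caratheodory_measure \<nu>) (1 / q))
            \<le> ennreal ((2 * \<gamma> * 8 powr p) powr (1 / p)) *
               epowr (\<integral>\<^sup>+ x\<in>\<Omega>. epowr (g x) p \<partial>caratheodory_measure \<mu>) (1 / p)"
        using ineq
        by (intro Poincare_inequality_of_conductor_inequality[OF assms(1,5,4) finite pq \<open>0 < \<gamma>\<close>])
           (auto simp: newtonian_continuous_def)
    qed
  next
    fix c :: real
    assume "0 < c" and ineq: "\<forall>u \<in> newtonian_continuous \<mu> \<Omega> p. \<forall>g.
            weak_upper_gradient \<mu> \<Omega> p (\<lambda>x. ereal (u x)) g \<longrightarrow>
            (INF a::real. epowr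
               (\<integral>\<^sup>+ x\<in>\<Omega>. ennreal (\<bar>u x - a\<bar> powr q) \<partial>caratheodory_measure \<nu>) (1 / q))
            \<le> ennreal c *
               epowr (\<integral>\<^sup>+ x\<in>\<Omega>. epowr (g x) p \<partial>caratheodory_measure \<mu>) (1 / p)"
    show "\<exists>\<gamma>::real. 0 < \<gamma> \<and>
         (\<forall>F G. conductor \<Omega> F G \<and> \<nu> G \<le> \<nu> \<Omega> / 2 \<and> \<nu> G < \<infinity> \<longrightarrow>
            epowr (\<nu> F) (p / q) \<le> ennreal \<gamma> * conductivity \<mu> p F G \<Omega>)"
    proof (intro exI conjI allI impI; (elim conjE)?)
      show "0 < (2 * c) powr p" using \<open>0 < c\<close> by simp
    next
      fix F G assume "conductor \<Omega> F G" "\<nu> G \<le> \<nu> \<Omega> / 2" "\<nu> G < \<infinity>"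
      then show "epowr (\<nu> F) (p / q) \<le> ennreal ((2 * c) powr p) * conductivity \<mu> p F G \<Omega>"
        using ineq
        by (intro conductor_inequality_of_Poincare_inequality[OF assms(5,4) pq \<open>0 < c\<close>]) auto
    qed
  qed
qed

end
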